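(* Let $\alpha<\frac12$ and $1\le p\le\infty$. For $f\in L^p(0,1)$ let $u_D=u_{D,f}$ denote the unique function in $W^{2,p}_{loc}((0,1])$ satisfying $-(x^{2\alpha}u_D'(x))'+u_D(x)=f(x)$ for a.e. $x\in(0,1]$, $u_D(1)=0$ and $\lim_{x\to0^+}u_D(x)=0$. Define, for $x\in(0,1]$, $$K_D(x):=\sup_{\|f\|_{L^p}\le1}\left|x^{2\alpha-1}u_{D,f}(x)\right|.$$ Then there exist $\varepsilon_0>0$, $C_1>0$ and $C_2>C_1$ such that $C_1\le K_D(x)\le C_2$ for all $0<x\le\varepsilon_0$.
   Context: All functions are real valued. $W^{2,p}_{loc}((0,1])$ is the set of functions on $(0,1]$ belonging to $W^{2,p}(\delta,1)$ for every $\delta\in(0,1)$. Such a solution $u_{D,f}$ exists and is unique for every $f\in L^p(0,1)$. The supremum is over $f\in L^p(0,1)$; the constants $\varepsilon_0,C_1,C_2$ may depend on $\alpha$ and $p$. *)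

theory Defs
  imports "HOL-Analysis.Analysis" "HOL-Probability.Essential_Supremum"
begin

section \<open>Lebesgue spaces\<close>

text \<open>Functions are total; only their values on \<open>I\<close> matter, and elements of \<open>L\<^sup>p\<close> are
  represented by Lebesgue measurable functions. The library has no power function on
  \<^typ>\<open>ennreal\<close>, so the \<open>p\<close>-th root of a finite integral is taken in the reals.\<close>

definition Lp_norm :: "ennreal \<Rightarrow> real set \<Rightarrow> (real \<Rightarrow> real) \<Rightarrow> ennreal" where
  "Lp_norm p I f =
     (if p = \<infinity> then esssup (lebesgue_on I) (\<lambda>x. ennreal \<bar>f x\<bar>)
      else (let J = \<integral>\<^sup>+ x. ennreal (\<bar>f x\<bar> powr enn2real p) \<partial>lebesgue_on I
            in if J = \<infinity> then \<infinity> else ennreal (enn2real J powr (1 / enn2real p))))"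

definition Lp :: "ennreal \<Rightarrow> real set \<Rightarrow> (real \<Rightarrow> real) set" where
  "Lp p I = {f. f \<in> borel_measurable (lebesgue_on I) \<and> Lp_norm p I f < \<infinity>}"

section \<open>Weak derivatives and Sobolev spaces on open intervals\<close>

definition locally_integrable :: "real set \<Rightarrow> (real \<Rightarrow> real) \<Rightarrow> bool" where
  "locally_integrable I u \<longleftrightarrow> (\<forall>K. compact K \<and> K \<subseteq> I \<longrightarrow> set_integrable lebesgue K u)"

text \<open>The space \<open>C\<^sub>c\<^sup>1(I)\<close>, each function being extended by zero to the whole line.\<close>

definition test_functions :: "real set \<Rightarrow> (real \<Rightarrow> real) set" where
  "test_functions I =
     {\<phi>. \<phi> C1_differentiable_on UNIV \<and> (\<exists>K. compact K \<and> K \<subseteq> I \<and> (\<forall>x. x \<notin> K \<longrightarrow> \<phi> x = 0))}"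

definition has_weak_derivative :: "real set \<Rightarrow> (real \<Rightarrow> real) \<Rightarrow> (real \<Rightarrow> real) \<Rightarrow> bool" where
  "has_weak_derivative I u v \<longleftrightarrow>
     locally_integrable I u \<and> locally_integrable I v \<and>
     (\<forall>\<phi>\<in>test_functions I.
        (LINT x|lebesgue_on I. u x * deriv \<phi> x) = - (LINT x|lebesgue_on I. v x * \<phi> x))"

definition W1 :: "ennreal \<Rightarrow> real set \<Rightarrow> (real \<Rightarrow> real) set" where
  "W1 p I = {u \<in> Lp p I. \<exists>v\<in>Lp p I. has_weak_derivative I u v}"

definition W2 :: "ennreal \<Rightarrow> real set \<Rightarrow> (real \<Rightarrow> real) set" where
  "W2 p I = {u \<in> Lp p I. \<exists>v\<in>W1 p I. has_weak_derivative I u v}"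

text \<open>\<open>W\<^sup>2\<^sup>,\<^sup>p\<^sub>l\<^sub>o\<^sub>c((0,1])\<close>. Functions in it are evaluated pointwise (in particular at \<open>1\<close>), so
  each class is identified with its unique representative that is continuous on \<open>(0,1]\<close>.\<close>

definition W2_loc :: "ennreal \<Rightarrow> (real \<Rightarrow> real) set" where
  "W2_loc p = {u. continuous_on {0<..1} u \<and> (\<forall>\<delta>\<in>{0<..<1}. u \<in> W2 p {\<delta><..<1})}"

section \<open>The Dirichlet problem\<close>

text \<open>In the next definition \<open>v\<close> is \<open>u'\<close> and \<open>w\<close> is \<open>(x\<^sup>2\<^sup>\<alpha> u')'\<close>; weak derivatives are unique
  up to null sets, so the choice of \<open>v\<close> and \<open>w\<close> is immaterial.\<close>

definition satisfies_ode :: "real \<Rightarrow> (real \<Rightarrow> real) \<Rightarrow> (real \<Rightarrow> real) \<Rightarrow> bool" where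
  "satisfies_ode \<alpha> f u \<longleftrightarrow>
     (\<exists>v w. has_weak_derivative {0<..<1} u v \<and>
            has_weak_derivative {0<..<1} (\<lambda>x. x powr (2 * \<alpha>) * v x) w \<and>
            (AE x in lebesgue_on {0<..1}. - w x + u x = f x))"

definition dirichlet_solution ::
    "real \<Rightarrow> ennreal \<Rightarrow> (real \<Rightarrow> real) \<Rightarrow> (real \<Rightarrow> real) \<Rightarrow> bool" where
  "dirichlet_solution \<alpha> p f u \<longleftrightarrow>
     u \<in> W2_loc p \<and> satisfies_ode \<alpha> f u \<and> u 1 = 0 \<and> (u \<longlongrightarrow> 0) (at_right 0)"

text \<open>Membership in \<^term>\<open>extensional {0<..1::real}\<close> fixes the irrelevant values outside \<open>(0,1]\<close>,
  so that uniqueness on \<open>(0,1]\<close> is uniqueness of a total function.\<close>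

definition u\<^sub>D :: "real \<Rightarrow> ennreal \<Rightarrow> (real \<Rightarrow> real) \<Rightarrow> real \<Rightarrow> real" where
  "u\<^sub>D \<alpha> p f = (THE u. u \<in> extensional {0<..1} \<and> dirichlet_solution \<alpha> p f u)"

text \<open>The supremum is taken in \<^typ>\<open>ennreal\<close>, so that its finiteness is not presupposed.\<close>

definition K\<^sub>D :: "real \<Rightarrow> ennreal \<Rightarrow> real \<Rightarrow> ennreal" where
  "K\<^sub>D \<alpha> p x =
     (SUP f \<in> {f \<in> Lp p {0<..<1}. Lp_norm p {0<..<1} f \<le> 1}.
        ennreal \<bar>x powr (2 * \<alpha> - 1) * u\<^sub>D \<alpha> p f x\<bar>)"

end

theory Submission
  imports Defs
begin

text \<open>
  Write \<open>a(x) = x\<^sup>2\<^sup>\<alpha>\<close> and \<open>r = 1 - 2\<alpha> > 0\<close>. Near the origin the term \<open>u\<close> in \<open>-(a u')' + u = f\<close> is a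
  perturbation, so homogeneous solutions behave like \<open>1\<close> and \<open>x\<^sup>r\<close>; the condition \<open>u(0) = 0\<close>
  selects the second behaviour, and \<open>x\<^sup>2\<^sup>\<alpha>\<^sup>-\<^sup>1\<close> is exactly its reciprocal.

  The homogeneous equation is solved by power series in \<open>t = x\<^sup>r\<^sup>+\<^sup>1\<close>: there are an increasing
  solution \<open>\<phi>(x) = x\<^sup>r F(t) / r\<close> vanishing at \<open>0\<close> and a solution \<open>\<zeta>(x) = G(t)\<close> with
  \<open>\<zeta>(0) = 1\<close>, with fluxes \<open>\<Phi> = a \<phi>'\<close>, \<open>Z = a \<zeta>'\<close> and Wronskian \<open>\<Phi> \<zeta> - Z \<phi> = 1\<close>. The locale
  \<open>homogeneous_solutions\<close> collects what is used about them.

  Upper bound. With \<open>\<psi> = \<zeta> - (\<zeta>(1)/\<phi>(1)) \<phi>\<close>, which vanishes at \<open>1\<close>, variation of parameters gives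
  \<open>u(x) = \<psi>(x) \<integral>\<^sub>0\<^sup>x \<phi> f + \<phi>(x) \<integral>\<^sub>x\<^sup>1 \<psi> f\<close>. As \<open>\<phi>\<close> increases, \<open>|u(x)| \<le> C \<phi>(x) \<integral>|f| \<le> C' x\<^sup>r \<integral>|f|\<close>,
  and \<open>\<integral>|f| \<le> 2\<close> on the unit ball of \<open>L\<^sup>p(0,1)\<close> (\<open>u\<^sub>D_bound\<close>, \<open>K\<^sub>D_upper_bound\<close>).

  Lower bound. The function \<open>u(x) = c x\<^sup>r (1 - x)\<close> has the smooth flux
  \<open>a u' = c (r - (r + 1) x)\<close>, hence solves the problem for the bounded datum \<open>f = c (r + 1) + u\<close>.
  For suitable \<open>c\<close> this \<open>f\<close> lies in the unit ball for every \<open>p\<close>, and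
  \<open>x\<^sup>2\<^sup>\<alpha>\<^sup>-\<^sup>1 u(x) = c (1 - x) \<ge> c / 2\<close> on \<open>(0,1/2]\<close> (\<open>K\<^sub>D_lower_bound\<close>).

  Both bounds concern a definite description, so uniqueness is needed in the weak class
  (\<open>dirichlet_solution_unique\<close>). The difference \<open>z\<close> of two solutions is continuous and satisfies
  \<open>\<integral> z (a \<eta>')' = \<integral> z \<eta>\<close> whenever \<open>\<eta>\<close> and \<open>a \<eta>'\<close> are \<open>C\<^sup>1\<close> with compact support. If a bump \<open>\<rho>\<close> is orthogonal to \<open>\<phi>\<close> and
  \<open>\<zeta>\<close>, then \<open>\<rho> = \<eta> - (a \<eta>')'\<close> with such an \<open>\<eta>\<close>, again by variation of parameters, so \<open>\<rho>\<close> is orthogonal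
  to \<open>z\<close> as well. Thus \<open>z\<close> is a combination of \<open>\<phi>\<close> and \<open>\<zeta>\<close>, and the boundary conditions make it
  vanish.
\<close>

section \<open>Test functions and weak derivatives\<close>

lemma test_function_derivative:
  assumes "\<phi> \<in> test_functions I"
  shows "(\<phi> has_real_derivative deriv \<phi> x) (at x)" "continuous_on S \<phi>" "continuous_on S (deriv \<phi>)"
proof -
  obtain D where D: "\<And>x. (\<phi> has_vector_derivative D x) (at x)" "continuous_on UNIV D"
    using assms by (auto simp: test_functions_def C1_differentiable_on_def)
  then have D': "(\<phi> has_real_derivative D x) (at x)" for x
    by (simp add: has_real_derivative_iff_has_vector_derivative)
  then have eq: "deriv \<phi> = D" by (auto intro: DERIV_imp_deriv)
  show "(\<phi> has_real_derivative deriv \<phi> x) (at x)" using D' eq by simp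
  show "continuous_on S \<phi>" using D' by (meson DERIV_continuous_on has_field_derivative_at_within)
  show "continuous_on S (deriv \<phi>)" using D(2) eq continuous_on_subset by blast
qed

lemma test_function_support:
  assumes "\<phi> \<in> test_functions I"
  shows "\<exists>K. compact K \<and> K \<subseteq> I \<and> (\<forall>x. x \<notin> K \<longrightarrow> \<phi> x = 0 \<and> deriv \<phi> x = 0)"
proof -
  obtain K where K: "compact K" "K \<subseteq> I" "\<And>x. x \<notin> K \<Longrightarrow> \<phi> x = 0"
    using assms by (auto simp: test_functions_def)
  have "deriv \<phi> x = 0" if "x \<notin> K" for x
  proof -
    have "((\<lambda>_. 0) has_real_derivative 0) (at x)" by simp
    then have "(\<phi> has_real_derivative 0) (at x)"
    proof (rule has_field_derivative_transform_within_open)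
      show "open (- K)" using K by (simp add: compact_imp_closed open_Compl)
    qed (use that K in auto)
    then show ?thesis by (rule DERIV_imp_deriv)
  qed
  then show ?thesis using K by blast
qed

text \<open>
  Gluing: a \<open>C\<^sup>1\<close> function on \<open>I\<close> that vanishes off a compact subset extends by zero, because the open
  sets \<open>I\<close> and \<open>- K\<close> cover the line.
\<close>

lemma test_functionI:
  assumes "open I" "compact K" "K \<subseteq> I"
    and g: "\<And>x. x \<in> I \<Longrightarrow> (g has_real_derivative g' x) (at x)" "continuous_on I g'"
    and z: "\<And>x. x \<in> I \<Longrightarrow> x \<notin> K \<Longrightarrow> g x = 0"
  defines "G \<equiv> (\<lambda>x. if x \<in> I then g x else 0)"
  shows "G \<in> test_functions I" "\<And>x. x \<in> I \<Longrightarrow> deriv G x = g' x"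
proof -
  define D where "D = (\<lambda>x. if x \<in> I then g' x else 0)"
  have oK: "open (- K)" using assms by (simp add: compact_imp_closed open_Compl)
  have dI: "(G has_real_derivative g' x) (at x)" if "x \<in> I" for x
    using g(1)[OF that] by (rule has_field_derivative_transform_within_open[OF _ \<open>open I\<close>])
      (use that in \<open>auto simp: G_def\<close>)
  have dK: "(G has_real_derivative 0) (at x)" if "x \<notin> K" for x
  proof -
    have "((\<lambda>_. 0) has_real_derivative 0) (at x)" by simp
    then show ?thesis by (rule has_field_derivative_transform_within_open[OF _ oK])
      (use that z in \<open>auto simp: G_def\<close>)
  qed
  have d: "(G has_real_derivative D x) (at x)" for x
    using dI[of x] dK[of x] \<open>K \<subseteq> I\<close> by (auto simp: D_def)
  have Dz: "D x = 0" if "x \<notin> K" for x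
    using d dK[OF that] DERIV_unique by blast
  have "continuous_on (I \<union> - K) D"
  proof (rule continuous_on_open_Un)
    show "continuous_on I D" using g(2) by (rule continuous_on_eq) (simp add: D_def)
    show "continuous_on (- K) D" by (rule continuous_on_eq[of _ "\<lambda>_. 0"]) (auto simp: Dz)
  qed (use \<open>open I\<close> oK in auto)
  moreover have "I \<union> - K = UNIV" using \<open>K \<subseteq> I\<close> by auto
  ultimately have "continuous_on UNIV D" by simp
  then have "G C1_differentiable_on UNIV" using d 
    by (auto simp: C1_differentiable_on_def has_real_derivative_iff_has_vector_derivative)
  then show "G \<in> test_functions I" using assms(2,3) z by (auto simp: test_functions_def G_def)
  show "deriv G x = g' x" if "x \<in> I" for x using dI[OF that] by (rule DERIV_imp_deriv)
qed

lemma lebesgue_on_zero_outside: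
  fixes g :: "real \<Rightarrow> real"
  assumes "I \<in> sets lebesgue" "\<And>x. x \<notin> I \<Longrightarrow> g x = 0"
  shows "(LINT x|lebesgue_on I. g x) = (LINT x|lebesgue. g x)"
    "integrable (lebesgue_on I) g \<longleftrightarrow> integrable lebesgue g"
proof -
  have "(\<lambda>x. indicator I x *\<^sub>R g x) = g" using assms by (auto simp: fun_eq_iff indicator_def)
  then show "(LINT x|lebesgue_on I. g x) = (LINT x|lebesgue. g x)"
    "integrable (lebesgue_on I) g \<longleftrightarrow> integrable lebesgue g"
    using assms(1) integral_restrict_space[of I lebesgue g] integrable_restrict_space[of I lebesgue g] by auto
qed

text \<open>
  Since test functions vanish outside \<open>I\<close>, the integrals can be taken over the whole line, which
  removes all bookkeeping about restricted measures.
\<close>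

lemma weak_derivative_iff:
  assumes "open I"
  shows "has_weak_derivative I u v \<longleftrightarrow>
     locally_integrable I u \<and> locally_integrable I v \<and>
     (\<forall>\<phi>\<in>test_functions I. (LINT x|lebesgue. u x * deriv \<phi> x) = - (LINT x|lebesgue. v x * \<phi> x))"
proof -
  have "(LINT x|lebesgue_on I. u x * deriv \<phi> x) = (LINT x|lebesgue. u x * deriv \<phi> x) \<and>
       (LINT x|lebesgue_on I. v x * \<phi> x) = (LINT x|lebesgue. v x * \<phi> x)" if \<phi>: "\<phi> \<in> test_functions I" for \<phi>
  proof -
    from \<phi> obtain K where "compact K \<and> K \<subseteq> I \<and> (\<forall>x. x \<notin> K \<longrightarrow> \<phi> x = 0 \<and> deriv \<phi> x = 0)"
    using test_function_support by blast
  then have K: "compact K" "K \<subseteq> I" "\<And>x. x \<notin> K \<Longrightarrow> \<phi> x = 0" "\<And>x. x \<notin> K \<Longrightarrow> deriv \<phi> x = 0"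
    by auto
    have z: "\<phi> x = 0" "deriv \<phi> x = 0" if "x \<notin> I" for x using that K(2-4) by blast+
    have "I \<in> sets lebesgue" using assms by (simp add: borel_open)
    then show ?thesis by (simp add: lebesgue_on_zero_outside(1) z)
  qed
  then show ?thesis unfolding has_weak_derivative_def by auto
qed

lemma locally_integrable_times_compact:
  fixes u h :: "real \<Rightarrow> real"
  assumes "locally_integrable I u" "compact K" "K \<subseteq> I" "continuous_on K h" "\<And>x. x \<notin> K \<Longrightarrow> h x = 0"
  shows "integrable lebesgue (\<lambda>x. u x * h x)"
proof -
  have Kl: "K \<in> sets lebesgue" using assms(2) by (simp add: lmeasurable_compact fmeasurableD)
  have "set_integrable lebesgue K u" using assms by (auto simp: locally_integrable_def)
  then have "(\<lambda>x. h x * u x) absolutely_integrable_on K"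
    using assms(2,4) Kl
    by (intro absolutely_integrable_bounded_measurable_product_real 
          continuous_imp_measurable_on_sets_lebesgue compact_imp_bounded compact_continuous_image)
  moreover have "(\<lambda>x. indicat_real K x *\<^sub>R (h x * u x)) = (\<lambda>x. u x * h x)"
    using assms(5) by (auto simp: fun_eq_iff indicator_def)
  ultimately show ?thesis by (simp add: set_integrable_def)
qed

lemma locally_integrable_times_continuous:
  fixes u h :: "real \<Rightarrow> real"
  assumes "locally_integrable I u" "continuous_on I h"
  shows "locally_integrable I (\<lambda>x. h x * u x)"
  unfolding locally_integrable_def
proof safe
  fix K assume K: "compact K" "K \<subseteq> I"
  have Kl: "K \<in> sets lebesgue" using K by (simp add: lmeasurable_compact fmeasurableD)
  have "continuous_on K h" using assms K continuous_on_subset by blast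
  moreover have "set_integrable lebesgue K u" using assms K by (auto simp: locally_integrable_def)
  ultimately show "(\<lambda>x. h x * u x) absolutely_integrable_on K"
    using K Kl
    by (intro absolutely_integrable_bounded_measurable_product_real 
          continuous_imp_measurable_on_sets_lebesgue compact_imp_bounded compact_continuous_image)
qed

lemma locally_integrable_continuous:
  fixes h :: "real \<Rightarrow> real"
  assumes "continuous_on I h"
  shows "locally_integrable I h"
proof -
  have "locally_integrable I (\<lambda>_. 1 :: real)"
    using lmeasurable_compact by (auto simp: locally_integrable_def intro!: absolutely_integrable_on_const)
  from locally_integrable_times_continuous[OF this assms] show ?thesis by simp
qed

lemma has_weak_derivative_diff:
  assumes "open I" "has_weak_derivative I u v" "has_weak_derivative I u' v'"
  shows "has_weak_derivative I (\<lambda>x. u x - u' x) (\<lambda>x. v x - v' x)"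
  unfolding weak_derivative_iff[OF assms(1)]
proof safe
  show "locally_integrable I (\<lambda>x. u x - u' x)" "locally_integrable I (\<lambda>x. v x - v' x)"
    using assms unfolding has_weak_derivative_def locally_integrable_def by (auto intro: set_integral_diff)
next
  fix \<phi> assume p: "\<phi> \<in> test_functions I"
  then obtain K where "compact K \<and> K \<subseteq> I \<and> (\<forall>x. x \<notin> K \<longrightarrow> \<phi> x = 0 \<and> deriv \<phi> x = 0)"
    using test_function_support by blast
  then have K: "compact K" "K \<subseteq> I" "\<And>x. x \<notin> K \<Longrightarrow> \<phi> x = 0" "\<And>x. x \<notin> K \<Longrightarrow> deriv \<phi> x = 0"
    by auto
  note c = test_function_derivative(2,3)[OF p]
  note int = locally_integrable_times_compact[OF _ K(1,2) c(1) K(3)] locally_integrable_times_compact[OF _ K(1,2) c(2) K(4)]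
  show "(LINT x|lebesgue. (u x - u' x) * deriv \<phi> x) = - (LINT x|lebesgue. (v x - v' x) * \<phi> x)"
  proof -
    have l: "locally_integrable I u" "locally_integrable I u'" "locally_integrable I v" "locally_integrable I v'"
      using assms(2,3) by (auto simp: has_weak_derivative_def)
    have "(LINT x|lebesgue. u x * deriv \<phi> x) = - (LINT x|lebesgue. v x * \<phi> x)"
         "(LINT x|lebesgue. u' x * deriv \<phi> x) = - (LINT x|lebesgue. v' x * \<phi> x)"
      using assms(2,3) p unfolding weak_derivative_iff[OF assms(1)] by blast+
    then show ?thesis
      unfolding left_diff_distrib
      by (simp add: int(1)[OF l(3)] int(1)[OF l(4)] int(2)[OF l(1)] int(2)[OF l(2)])
  qed
qed

lemma has_weak_derivative_subset:
  assumes "has_weak_derivative I u v" "J \<subseteq> I" "open I" "open J"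
  shows "has_weak_derivative J u v"
proof -
  have "test_functions J \<subseteq> test_functions I" using assms(2) unfolding test_functions_def by blast
  moreover have "locally_integrable I u \<Longrightarrow> locally_integrable J u" for u
    using assms(2) by (auto simp: locally_integrable_def)
  ultimately show ?thesis using assms(1) 
    unfolding weak_derivative_iff[OF assms(3)] weak_derivative_iff[OF assms(4)] by blast
qed

lemma has_weak_derivative_cong:
  assumes "has_weak_derivative I u v" "\<And>x. x \<in> I \<Longrightarrow> u x = u' x" "\<And>x. x \<in> I \<Longrightarrow> v x = v' x" 
  shows "has_weak_derivative I u' v'"
proof -
  have l: "locally_integrable I f = locally_integrable I g" if "\<And>x. x \<in> I \<Longrightarrow> f x = g x" for f g
    unfolding locally_integrable_def using that by (intro all_cong set_integrable_cong) auto
  have i: "(LINT x|lebesgue_on I. f x * h x) = (LINT x|lebesgue_on I. g x * h x)" 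
    if "\<And>x. x \<in> I \<Longrightarrow> f x = g x" for f g h :: "real \<Rightarrow> real"
    using that by (intro Bochner_Integration.integral_cong) auto
  show ?thesis using assms(1) l[OF assms(2)] l[OF assms(3)] i[OF assms(2)] i[OF assms(3)]
    unfolding has_weak_derivative_def by simp
qed

text \<open>
  The product rule with a \<open>C\<^sup>1\<close> factor: \<open>g \<phi>\<close> is again a test function, so it can be inserted in the
  definition.
\<close>

lemma has_weak_derivative_mult:
  assumes I: "open I" and w: "has_weak_derivative I u v"
    and g: "\<And>x. x \<in> I \<Longrightarrow> (g has_real_derivative g' x) (at x)" "continuous_on I g'"
  shows "has_weak_derivative I (\<lambda>x. g x * u x) (\<lambda>x. g' x * u x + g x * v x)"
  unfolding weak_derivative_iff[OF I]
proof safe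
  have cg: "continuous_on I g" using g(1) by (meson DERIV_continuous_on has_field_derivative_at_within)
  have lu: "locally_integrable I u" "locally_integrable I v" using w by (auto simp: has_weak_derivative_def)
  show "locally_integrable I (\<lambda>x. g x * u x)" 
    using lu cg by (intro locally_integrable_times_continuous)
  show "locally_integrable I (\<lambda>x. g' x * u x + g x * v x)" 
    using locally_integrable_times_continuous[OF lu(1) g(2)] locally_integrable_times_continuous[OF lu(2) cg]
    by (auto simp: locally_integrable_def intro: set_integral_add)
  fix \<phi> assume p: "\<phi> \<in> test_functions I"
  then obtain K where "compact K \<and> K \<subseteq> I \<and> (\<forall>x. x \<notin> K \<longrightarrow> \<phi> x = 0 \<and> deriv \<phi> x = 0)"
    using test_function_support by blast
  then have K: "compact K" "K \<subseteq> I" "\<And>x. x \<notin> K \<Longrightarrow> \<phi> x = 0" "\<And>x. x \<notin> K \<Longrightarrow> deriv \<phi> x = 0"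
    by auto
  define \<theta> where "\<theta> = (\<lambda>x. if x \<in> I then g x * \<phi> x else 0)"
  note c = test_function_derivative(2,3)[OF p]
  have d: "((\<lambda>x. g x * \<phi> x) has_real_derivative g' x * \<phi> x + deriv \<phi> x * g x) (at x)" if "x \<in> I" for x
    by (rule DERIV_mult[OF g(1)[OF that] test_function_derivative(1)[OF p]])
  have cd: "continuous_on I (\<lambda>x. g' x * \<phi> x + deriv \<phi> x * g x)"
    by (intro continuous_intros c cg g(2))
  have t: "\<theta> \<in> test_functions I" "\<And>x. x \<in> I \<Longrightarrow> deriv \<theta> x = g' x * \<phi> x + deriv \<phi> x * g x"
    unfolding \<theta>_def using test_functionI[OF I K(1,2) d cd] K(3) by auto
  have cK: "continuous_on K (\<lambda>x. g' x * \<phi> x)" "continuous_on K (\<lambda>x. g x * deriv \<phi> x)" "continuous_on K (\<lambda>x. g x * \<phi> x)"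
    using K(2) by (auto intro!: continuous_intros c intro: continuous_on_subset[OF cg] continuous_on_subset[OF g(2)])
  have int: "integrable lebesgue (\<lambda>x. u x * (g' x * \<phi> x))" "integrable lebesgue (\<lambda>x. u x * (g x * deriv \<phi> x))"
    "integrable lebesgue (\<lambda>x. v x * (g x * \<phi> x))"
    by (intro locally_integrable_times_compact[OF _ K(1,2)] lu cK; simp add: K)+
  have 1: "u x * deriv \<theta> x = u x * (g' x * \<phi> x) + u x * (g x * deriv \<phi> x)" for x
  proof (cases "x \<in> I")
    case True then show ?thesis by (simp add: t algebra_simps)
  next
    case False
    have "deriv \<theta> x = 0" using test_function_support[OF t(1)] False by blast
    moreover have "\<phi> x = 0" "deriv \<phi> x = 0" using False K(2-4) by blast+
    ultimately show ?thesis by simp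
  qed
  have 2: "v x * \<theta> x = v x * (g x * \<phi> x)" for x using K by (auto simp: \<theta>_def)
  have "(LINT x|lebesgue. u x * deriv \<theta> x) = - (LINT x|lebesgue. v x * \<theta> x)"
    using w t(1) unfolding weak_derivative_iff[OF I] by blast
  then have "(LINT x|lebesgue. u x * (g x * deriv \<phi> x)) = 
      - ((LINT x|lebesgue. u x * (g' x * \<phi> x)) + (LINT x|lebesgue. v x * (g x * \<phi> x)))"
    unfolding 1 2 by (simp add: int)
  also have "\<dots> = - (LINT x|lebesgue. u x * (g' x * \<phi> x) + v x * (g x * \<phi> x))" by (simp add: int)
  finally show "(LINT x|lebesgue. g x * u x * deriv \<phi> x) = - (LINT x|lebesgue. (g' x * u x + g x * v x) * \<phi> x)"
    by (simp add: algebra_simps)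
qed

lemma integral_deriv_above:
  assumes p: "\<phi> \<in> test_functions {a<..<b}" and t: "a \<le> t" "t \<le> b"
  shows "(LINT x|lborel. (if t \<le> x then deriv \<phi> x else 0)) = - \<phi> t"
proof -
  obtain K where "compact K \<and> K \<subseteq> {a<..<b} \<and> (\<forall>x. x \<notin> K \<longrightarrow> \<phi> x = 0 \<and> deriv \<phi> x = 0)"
    using test_function_support[OF p] by blast
  then have K: "compact K" "K \<subseteq> {a<..<b}" "\<And>x. x \<notin> K \<Longrightarrow> \<phi> x = 0" "\<And>x. x \<notin> K \<Longrightarrow> deriv \<phi> x = 0"
    by auto
  have z: "\<phi> x = 0 \<and> deriv \<phi> x = 0" if "x \<le> a \<or> b \<le> x" for x
  proof -
    have "x \<notin> K" using K(2) that by auto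
    then show ?thesis using K by simp
  qed
  then have nz: "\<phi> x \<noteq> 0 \<Longrightarrow> a < x \<and> x < b" "deriv \<phi> x \<noteq> 0 \<Longrightarrow> a < x \<and> x < b" for x
    by (meson not_le)+
  note d = test_function_derivative[OF p]
  have "(LINT x|lborel. (if t \<le> x then deriv \<phi> x else 0)) = (LINT x|lborel. indicator {t..b} x *\<^sub>R deriv \<phi> x)"
    using z by (intro Bochner_Integration.integral_cong) (auto simp: indicator_def)
  also have "\<dots> = \<phi> b - \<phi> t"
    using d(1) t by (intro integral_FTC_Icc) 
      (auto intro: d(3) has_field_derivative_at_within 
        simp flip: has_real_derivative_iff_has_vector_derivative)
  also have "\<phi> b = 0" using z by simp
  finally show ?thesis by simp
qed

text \<open>
  Fubini's theorem on the triangle \<open>t \<le> x\<close>: integrating \<open>\<phi>'(x) h(t)\<close> over \<open>t\<close> first gives \<open>\<phi>'(x) \<integral>\<^sub>a\<^sup>x h\<close>, over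
  \<open>x\<close> first gives \<open>- \<phi>(t) h(t)\<close>.
\<close>

lemma has_weak_derivative_primitive:
  assumes h: "h absolutely_integrable_on {a..b}"
  shows "has_weak_derivative {a<..<b} (\<lambda>x. C + integral {a..x} h) h"
  unfolding weak_derivative_iff[OF open_greaterThanLessThan]
proof safe
  have "h integrable_on {a..b}" using h set_lebesgue_integral_eq_integral(1) by blast
  then have c: "continuous_on {a..b} (\<lambda>x. integral {a..x} h)"
    by (rule indefinite_integral_continuous_1)
  show lu: "locally_integrable {a<..<b} (\<lambda>x. C + integral {a..x} h)"
    by (intro locally_integrable_continuous continuous_intros continuous_on_subset[OF c]) auto
  show "locally_integrable {a<..<b} h"
    unfolding locally_integrable_def using h
    by (auto intro!: set_integrable_subset[OF h] simp: lmeasurable_compact fmeasurableD)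
  fix \<phi> assume p: "\<phi> \<in> test_functions {a<..<b}"
  obtain K where "compact K \<and> K \<subseteq> {a<..<b} \<and> (\<forall>x. x \<notin> K \<longrightarrow> \<phi> x = 0 \<and> deriv \<phi> x = 0)"
    using test_function_support[OF p] by blast
  then have K: "compact K" "K \<subseteq> {a<..<b}" "\<And>x. x \<notin> K \<Longrightarrow> \<phi> x = 0" "\<And>x. x \<notin> K \<Longrightarrow> deriv \<phi> x = 0"
    by auto
  have z: "\<phi> x = 0 \<and> deriv \<phi> x = 0" if "x \<le> a \<or> b \<le> x" for x
  proof -
    have "x \<notin> K" using K(2) that by auto
    then show ?thesis using K by simp
  qed
  then have nz: "\<phi> x \<noteq> 0 \<Longrightarrow> a < x \<and> x < b" "deriv \<phi> x \<noteq> 0 \<Longrightarrow> a < x \<and> x < b" for x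
    by (meson not_le)+
  note d = test_function_derivative[OF p]
  define h0 where "h0 = (\<lambda>t. indicator {a..b} t * h t)"
  have ih0: "integrable lebesgue h0" using h by (simp add: h0_def set_integrable_def)
  \<comment> \<open>The product measure is that of Borel sets, so \<open>h\<close> is exchanged for a Borel representative.\<close>
  then obtain h' where h'[measurable]: "h' \<in> borel_measurable lborel" and ae: "AE x in lborel. h0 x = h' x"
    using completion_ex_borel_measurable_real[of h0 lborel] by auto
  then have ae': "AE x in lebesgue. h0 x = h' x" by (simp add: AE_completion)
  then have ih': "integrable lebesgue h'"
    using ih0 h' by (subst integrable_cong_AE[of _ _ h0]) (auto intro: measurable_completion)
  then have ih: "integrable lborel h'" using h' by (simp add: integrable_completion)
  have m[measurable]: "deriv \<phi> \<in> borel_measurable borel" using d(3) by (rule borel_measurable_continuous_onI)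
  have "set_integrable lborel {a..b} (deriv \<phi>)" by (rule borel_integrable_atLeastAtMost'[OF d(3)])
  moreover have "(\<lambda>x. indicat_real {a..b} x *\<^sub>R deriv \<phi> x) = deriv \<phi>"
    using nz by (force simp: fun_eq_iff indicator_def)
  ultimately have ip: "integrable lborel (deriv \<phi>)" by (simp add: set_integrable_def)
  define k where "k = (\<lambda>x t. deriv \<phi> x * (if t \<le> x then h' t else 0))"
  have km: "case_prod k \<in> borel_measurable (lborel \<Otimes>\<^sub>M lborel)"
    unfolding k_def by measurable
  have dom: "integrable (lborel \<Otimes>\<^sub>M lborel) (\<lambda>(x, t). deriv \<phi> x * h' t)"
    by (rule lborel_pair.Fubini_integrable) (use ip ih in \<open>auto simp: abs_mult\<close>)
  have ik: "integrable (lborel \<Otimes>\<^sub>M lborel) (case_prod k)"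
    by (rule Bochner_Integration.integrable_bound[OF dom km]) (auto simp: k_def)
  have fub: "(\<integral>t. (\<integral>x. k x t \<partial>lborel) \<partial>lborel) = (\<integral>x. (\<integral>t. k x t \<partial>lborel) \<partial>lborel)"
    using ik by (rule lborel_pair.Fubini_integral)
  have inner_t: "(\<integral>t. k x t \<partial>lborel) = deriv \<phi> x * integral {a..x} h" for x
  proof (cases "x \<in> {a..b}")
    case True
    have "(\<integral>t. (if t \<le> x then h' t else 0) \<partial>lborel) = (LINT t|lebesgue. (if t \<le> x then h' t else 0))"
      by (rule integral_completion[symmetric]) simp
    also have "\<dots> = (LINT t|lebesgue. indicator {a..x} t *\<^sub>R h t)"
    proof (rule integral_cong_AE)
      show "AE t in lebesgue. (if t \<le> x then h' t else 0) = indicator {a..x} t *\<^sub>R h t"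
        using ae' by eventually_elim (use True in \<open>auto simp: h0_def indicator_def split: if_splits\<close>)
      show "(\<lambda>t. indicat_real {a..x} t *\<^sub>R h t) \<in> borel_measurable lebesgue"
        using set_integrable_subset[OF h, of "{a..x}"] True by (auto simp: set_integrable_def)
      show "(\<lambda>t. if t \<le> x then h' t else 0) \<in> borel_measurable lebesgue"
        by (rule measurable_completion) simp
    qed
    also have "\<dots> = integral {a..x} h"
      using set_lebesgue_integral_eq_integral(2)[of "{a..x}" h] set_integrable_subset[OF h, of "{a..x}"] True
      by (auto simp: set_lebesgue_integral_def)
    finally show ?thesis by (simp add: k_def)
  next
    case False
    then have "deriv \<phi> x = 0" using z by auto
    then show ?thesis by (simp add: k_def)
  qed
  have inner_x: "(\<integral>x. k x t \<partial>lborel) = - (\<phi> t * h' t)" if "t \<in> {a..b}" for t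
  proof -
    have "(\<integral>x. k x t \<partial>lborel) = (\<integral>x. h' t * (if t \<le> x then deriv \<phi> x else 0) \<partial>lborel)"
      by (rule Bochner_Integration.integral_cong) (auto simp: k_def)
    also have "\<dots> = h' t * (- \<phi> t)" using integral_deriv_above[OF p, of t] that by simp
    finally show ?thesis by simp
  qed
  have ae2: "AE t in lborel. (\<integral>x. k x t \<partial>lborel) = - (\<phi> t * h' t)"
    using ae
  proof eventually_elim
    case (elim t)
    show ?case
    proof (cases "t \<in> {a..b}")
      case False
      then have "h' t = 0" using elim by (simp add: h0_def)
      then have "k x t = 0" for x by (simp add: k_def)
      then show ?thesis using \<open>h' t = 0\<close> by simp
    qed (rule inner_x)
  qed
  have m\<phi>[measurable]: "\<phi> \<in> borel_measurable borel" using d(2) by (rule borel_measurable_continuous_onI)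
  have mk: "(\<lambda>t. \<integral>x. k x t \<partial>lborel) \<in> borel_measurable lborel"
    using lborel_pair.integrable_snd[OF ik] by blast
  have "(LINT x|lebesgue. integral {a..x} h * deriv \<phi> x) = (LINT x|lborel. deriv \<phi> x * integral {a..x} h)"
  proof -
    have "(\<lambda>x. \<integral>t. k x t \<partial>lborel) \<in> borel_measurable lborel" using lborel_pair.integrable_fst[OF ik] by blast
    then have "(\<lambda>x. deriv \<phi> x * integral {a..x} h) \<in> borel_measurable lborel" unfolding inner_t .
    from integral_completion[OF this] show ?thesis by (simp add: mult.commute)
  qed
  also have "\<dots> = (\<integral>t. (\<integral>x. k x t \<partial>lborel) \<partial>lborel)" by (simp add: fub inner_t)
  also have "\<dots> = (\<integral>t. - (\<phi> t * h' t) \<partial>lborel)"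
    by (rule integral_cong_AE[OF mk _ ae2]) simp
  also have "\<dots> = (LINT t|lebesgue. - (\<phi> t * h' t))"
    by (rule integral_completion[symmetric]) simp
  also have "\<dots> = (LINT t|lebesgue. - (h t * \<phi> t))"
  proof (rule integral_cong_AE)
    have eq: "h t * \<phi> t = h0 t * \<phi> t" for t using nz by (force simp: h0_def indicator_def)
    show "(\<lambda>t. - (h t * \<phi> t)) \<in> borel_measurable lebesgue"
    proof -
      have "h0 \<in> borel_measurable lebesgue" using ih0 by (rule borel_measurable_integrable)
      moreover have "\<phi> \<in> borel_measurable lebesgue" by (rule measurable_completion) simp
      ultimately show ?thesis unfolding eq by (intro borel_measurable_uminus borel_measurable_times)
    qed
    show "(\<lambda>t. - (\<phi> t * h' t)) \<in> borel_measurable lebesgue"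
      by (rule measurable_completion) simp
    show "AE t in lebesgue. - (\<phi> t * h' t) = - (h t * \<phi> t)"
      using ae' by eventually_elim (simp add: eq)
  qed
  finally have 1: "(LINT x|lebesgue. integral {a..x} h * deriv \<phi> x) = - (LINT t|lebesgue. h t * \<phi> t)" by simp
  note cc = d(3)[of K]
  have 2: "(LINT x|lebesgue. deriv \<phi> x) = 0"
  proof (cases "a \<le> b")
    case True
    have "(LINT x|lebesgue. deriv \<phi> x) = (LINT x|lborel. deriv \<phi> x)" by (rule integral_completion) simp
    also have "\<dots> = (LINT x|lborel. (if a \<le> x then deriv \<phi> x else 0))"
      using z by (intro Bochner_Integration.integral_cong) auto
    also have "\<dots> = 0" using integral_deriv_above[OF p, of a] True z[of a] by auto
    finally show ?thesis .
  next
    case False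
    then have "deriv \<phi> x = 0" for x using z[of x] by linarith
    then show ?thesis by simp
  qed
  have i1: "integrable lebesgue (\<lambda>x. integral {a..x} h * deriv \<phi> x)"
    by (intro locally_integrable_times_compact[OF _ K(1,2) cc K(4)] locally_integrable_continuous continuous_on_subset[OF c]) auto
  have i2: "integrable lebesgue (\<lambda>x. C * deriv \<phi> x)"
    using ip by (simp add: integrable_completion)
  show "(LINT x|lebesgue. (C + integral {a..x} h) * deriv \<phi> x) = - (LINT x|lebesgue. h x * \<phi> x)"
    using 1 2 i1 i2 by (simp add: distrib_right)
qed

section \<open>Lebesgue spaces on intervals and the Dirichlet problem\<close>

lemma mem_Lp_iff:
  assumes "1 \<le> p"
  shows "f \<in> Lp p I \<longleftrightarrow> f \<in> borel_measurable (lebesgue_on I) \<and>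
    (if p = \<infinity> then \<exists>c. AE x in lebesgue_on I. \<bar>f x\<bar> \<le> c
     else (\<integral>\<^sup>+ x. ennreal (\<bar>f x\<bar> powr enn2real p) \<partial>lebesgue_on I) < \<infinity>)"
proof (cases "f \<in> borel_measurable (lebesgue_on I)")
  case m[measurable]: True
  show ?thesis
  proof (cases "p = \<infinity>")
    case True
    let ?e = "esssup (lebesgue_on I) (\<lambda>x. ennreal \<bar>f x\<bar>)"
    have "(\<exists>c. AE x in lebesgue_on I. \<bar>f x\<bar> \<le> c) \<longleftrightarrow> ?e < \<infinity>"
    proof
      assume "?e < \<infinity>"
      then obtain c where c: "?e = ennreal c" "0 \<le> c" by (metis ennreal_cases infinity_ennreal_def less_irrefl)
      have "AE x in lebesgue_on I. ennreal \<bar>f x\<bar> \<le> ?e" by (rule esssup_AE)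
      then have "AE x in lebesgue_on I. \<bar>f x\<bar> \<le> c" by eventually_elim (simp add: c)
      then show "\<exists>c. AE x in lebesgue_on I. \<bar>f x\<bar> \<le> c" by blast
    next
      assume "\<exists>c. AE x in lebesgue_on I. \<bar>f x\<bar> \<le> c"
      then obtain c where "AE x in lebesgue_on I. \<bar>f x\<bar> \<le> c" by blast
      then have "AE x in lebesgue_on I. ennreal \<bar>f x\<bar> \<le> ennreal c" by eventually_elim (simp add: ennreal_leI)
      then have "?e \<le> ennreal c" by (intro esssup_I) auto
      then show "?e < \<infinity>" by (simp add: le_less_trans)
    qed
    then show ?thesis using True m by (simp add: Lp_def Lp_norm_def)
  next
    case False
    then show ?thesis using m by (auto simp: Lp_def Lp_norm_def Let_def less_top)
  qed
qed (simp add: Lp_def)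

lemma exponent_ge_1:
  assumes "1 \<le> p" "p \<noteq> (\<infinity>::ennreal)"
  shows "1 \<le> enn2real p"
proof -
  have "enn2real 1 \<le> enn2real p" using assms by (intro enn2real_mono) (auto simp: less_top)
  then show ?thesis by simp
qed

lemma Lp_subset:
  assumes "1 \<le> p" "f \<in> Lp p I" "J \<subseteq> I" "I \<in> sets lebesgue" "J \<in> sets lebesgue"
  shows "f \<in> Lp p J"
proof -
  have m: "f \<in> borel_measurable (lebesgue_on I)" using assms mem_Lp_iff by blast
  have mJ: "f \<in> borel_measurable (lebesgue_on J)" 
    by (rule measurable_restrict_mono[OF m assms(3)])
  show ?thesis
  proof (cases "p = \<infinity>")
    case True
    then obtain c where "AE x in lebesgue_on I. \<bar>f x\<bar> \<le> c" using assms(1,2) mem_Lp_iff by auto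
    then have "AE x in lebesgue_on J. \<bar>f x\<bar> \<le> c"
      using assms(3-5) by (auto simp: AE_restrict_space_iff elim!: eventually_mono)
    then show ?thesis using True mJ assms(1) mem_Lp_iff by auto
  next
    case False
    have "(\<integral>\<^sup>+ x. ennreal (\<bar>f x\<bar> powr enn2real p) \<partial>lebesgue_on J) 
        \<le> (\<integral>\<^sup>+ x. ennreal (\<bar>f x\<bar> powr enn2real p) \<partial>lebesgue_on I)"
      using assms(3-5) by (auto simp: nn_integral_restrict_space indicator_def intro!: nn_integral_mono)
    also have "\<dots> < \<infinity>" using assms(1,2) False mem_Lp_iff by auto
    finally show ?thesis using False mJ assms(1) mem_Lp_iff by auto
  qed
qed

text \<open>
  For a bounded interval, \<open>L\<^sup>p\<close> absorbs bounded factors and bounded summands; the second derivative of a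
  solution is of this form, \<open>- a\<^sup>-\<^sup>1 f\<close> plus a function that is bounded on every \<open>(\<delta>,1)\<close>.
\<close>

lemma Lp_affine:
  assumes p: "1 \<le> p" and f: "f \<in> Lp p I" and I: "I \<in> lmeasurable"
    and g: "g \<in> borel_measurable (lebesgue_on I)" "\<And>x. x \<in> I \<Longrightarrow> \<bar>g x\<bar> \<le> A"
    and h: "h \<in> borel_measurable (lebesgue_on I)" "\<And>x. x \<in> I \<Longrightarrow> \<bar>h x\<bar> \<le> B"
  shows "(\<lambda>x. g x * f x + h x) \<in> Lp p I"
proof -
  note [measurable] = g(1) h(1)
  have Is: "I \<in> sets lebesgue" using I by blast
  have [measurable]: "f \<in> borel_measurable (lebesgue_on I)" using f p mem_Lp_iff by blast
  have bd: "\<bar>g x * f x + h x\<bar> \<le> \<bar>A\<bar> * \<bar>f x\<bar> + \<bar>B\<bar>" if "x \<in> I" for x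
  proof -
    have "\<bar>g x * f x + h x\<bar> \<le> \<bar>g x\<bar> * \<bar>f x\<bar> + \<bar>h x\<bar>" by (metis abs_mult abs_triangle_ineq)
    also have "\<dots> \<le> \<bar>A\<bar> * \<bar>f x\<bar> + \<bar>B\<bar>"
      using g(2)[OF that] h(2)[OF that] by (intro add_mono mult_right_mono) auto
    finally show ?thesis .
  qed
  show ?thesis
  proof (cases "p = \<infinity>")
    case True
    then obtain c where "AE x in lebesgue_on I. \<bar>f x\<bar> \<le> c" using p f mem_Lp_iff by auto
    then have "AE x in lebesgue_on I. \<bar>g x * f x + h x\<bar> \<le> \<bar>A\<bar> * c + \<bar>B\<bar>"
      using Is bd by (auto simp: AE_restrict_space_iff elim!: eventually_mono)
        (meson add_right_mono abs_ge_zero mult_left_mono order_trans)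
    then show ?thesis using True p mem_Lp_iff by auto
  next
    case False
    define q where "q = enn2real p"
    have q: "1 \<le> q" unfolding q_def using exponent_ge_1 p False by blast
    have pw: "\<bar>g x * f x + h x\<bar> powr q \<le> (2 * \<bar>A\<bar>) powr q * \<bar>f x\<bar> powr q + (2 * \<bar>B\<bar>) powr q" if "x \<in> I" for x
    proof -
      let ?m = "max (2 * \<bar>A\<bar> * \<bar>f x\<bar>) (2 * \<bar>B\<bar>)"
      have "\<bar>g x * f x + h x\<bar> \<le> ?m" using bd[OF that] by (simp add: max_def)
      then have "\<bar>g x * f x + h x\<bar> powr q \<le> ?m powr q" using q by (intro powr_mono2) auto
      also have "\<dots> \<le> (2 * \<bar>A\<bar> * \<bar>f x\<bar>) powr q + (2 * \<bar>B\<bar>) powr q" by (simp add: max_def)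
      also have "(2 * \<bar>A\<bar> * \<bar>f x\<bar>) powr q = (2 * \<bar>A\<bar>) powr q * \<bar>f x\<bar> powr q" by (simp add: powr_mult)
      finally show ?thesis .
    qed
    have "(\<integral>\<^sup>+ x. ennreal (\<bar>g x * f x + h x\<bar> powr q) \<partial>lebesgue_on I) 
      \<le> (\<integral>\<^sup>+ x. ennreal ((2 * \<bar>A\<bar>) powr q) * ennreal (\<bar>f x\<bar> powr q) + ennreal ((2 * \<bar>B\<bar>) powr q) \<partial>lebesgue_on I)"
    proof (intro nn_integral_mono)
      fix x assume "x \<in> space (lebesgue_on I)"
      then have "x \<in> I" by simp
      then have "ennreal (\<bar>g x * f x + h x\<bar> powr q) \<le> ennreal ((2 * \<bar>A\<bar>) powr q * \<bar>f x\<bar> powr q + (2 * \<bar>B\<bar>) powr q)"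
        by (intro ennreal_leI pw)
      then show "ennreal (\<bar>g x * f x + h x\<bar> powr q) \<le>
          ennreal ((2 * \<bar>A\<bar>) powr q) * ennreal (\<bar>f x\<bar> powr q) + ennreal ((2 * \<bar>B\<bar>) powr q)"
        by (simp add: ennreal_mult' ennreal_plus)
    qed
    also have "\<dots> = ennreal ((2 * \<bar>A\<bar>) powr q) * (\<integral>\<^sup>+ x. ennreal (\<bar>f x\<bar> powr q) \<partial>lebesgue_on I)
       + ennreal ((2 * \<bar>B\<bar>) powr q) * emeasure lebesgue I"
      using Is by (simp add: nn_integral_add nn_integral_cmult emeasure_restrict_space)
    also have "\<dots> < \<infinity>"
      using f p False I mem_Lp_iff by (auto simp: q_def ennreal_mult_less_top fmeasurable_def)
    finally show ?thesis using False p mem_Lp_iff unfolding q_def by auto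
  qed
qed

lemma bounded_mem_Lp:
  assumes "1 \<le> p" "I \<in> lmeasurable" "h \<in> borel_measurable (lebesgue_on I)" "\<And>x. x \<in> I \<Longrightarrow> \<bar>h x\<bar> \<le> B"
  shows "h \<in> Lp p I"
proof -
  have "(\<lambda>_. 0) \<in> Lp p I" using assms(1) by (auto simp: mem_Lp_iff[OF assms(1)])
  from Lp_affine[OF assms(1) this assms(2) _ _ assms(3,4), of "\<lambda>_. 0" 0] show ?thesis by simp
qed

lemma Lp_norm_le_1:
  assumes "1 \<le> p" "f \<in> borel_measurable (lebesgue_on {0<..<1})" "\<And>x. x \<in> {0<..<1} \<Longrightarrow> \<bar>f x\<bar> \<le> 1"
  shows "Lp_norm p {0<..<1} f \<le> 1"
proof (cases "p = \<infinity>")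
  case True
  have "esssup (lebesgue_on {0<..<1}) (\<lambda>x. ennreal \<bar>f x\<bar>) \<le> 1"
    using assms by (intro esssup_I) (auto intro!: AE_I2 simp: ennreal_le_1)
  then show ?thesis using True by (simp add: Lp_norm_def)
next
  case False
  define J where "J = (\<integral>\<^sup>+ x. ennreal (\<bar>f x\<bar> powr enn2real p) \<partial>lebesgue_on {0<..<1})"
  have q: "1 \<le> enn2real p" using exponent_ge_1 assms(1) False by blast
  have "J \<le> (\<integral>\<^sup>+ x. 1 \<partial>lebesgue_on {0<..<1::real})" unfolding J_def
    using q assms(3) by (intro nn_integral_mono) (auto simp: ennreal_le_1 intro!: powr_le1)
  also have "\<dots> = 1" by (simp add: emeasure_restrict_space)
  finally have J: "J \<le> 1" .
  then have "enn2real J \<le> 1" using enn2real_mono[of J 1] by simp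
  then have "enn2real J powr (1 / enn2real p) \<le> 1" using q by (intro powr_le1) auto
  then show ?thesis using False J by (auto simp: Lp_norm_def J_def[symmetric] ennreal_le_1 Let_def)
qed

text \<open>
  For finite \<open>p\<close>, integrate \<open>|f| \<le> 1 + |f|\<^sup>p\<close>; the bound \<open>2\<close> only has to be uniform over the ball.
\<close>

lemma unit_ball_L1:
  assumes "1 \<le> p" "f \<in> Lp p {0<..<1}" "Lp_norm p {0<..<1} f \<le> 1"
  shows "set_integrable lebesgue {0<..<1} f" "(LINT x:{0<..<1}|lebesgue. \<bar>f x\<bar>) \<le> 2"
proof -
  have m[measurable]: "f \<in> borel_measurable (lebesgue_on {0<..<1})" using assms mem_Lp_iff by blast
  have "(\<integral>\<^sup>+ x. ennreal \<bar>f x\<bar> \<partial>lebesgue_on {0<..<1}) \<le> 2"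
  proof (cases "p = \<infinity>")
    case True
    have "AE x in lebesgue_on {0<..<1}. ennreal \<bar>f x\<bar> \<le> esssup (lebesgue_on {0<..<1}) (\<lambda>x. ennreal \<bar>f x\<bar>)"
      by (rule esssup_AE)
    then have "AE x in lebesgue_on {0<..<1}. ennreal \<bar>f x\<bar> \<le> 1"
    proof eventually_elim
      case (elim x)
      have "esssup (lebesgue_on {0<..<1}) (\<lambda>x. ennreal \<bar>f x\<bar>) \<le> 1" using assms(3) True by (simp add: Lp_norm_def)
      with elim show ?case by (rule order_trans)
    qed
    then have "(\<integral>\<^sup>+ x. ennreal \<bar>f x\<bar> \<partial>lebesgue_on {0<..<1}) \<le> (\<integral>\<^sup>+ x. 1 \<partial>lebesgue_on {0<..<1::real})"
      by (rule nn_integral_mono_AE)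
    also have "\<dots> = 1" by (simp add: emeasure_restrict_space)
    also have "\<dots> \<le> 2" by simp
    finally show ?thesis .
  next
    case False
    define q where "q = enn2real p"
    have q: "1 \<le> q" unfolding q_def using exponent_ge_1 assms(1) False by blast
    define J where "J = (\<integral>\<^sup>+ x. ennreal (\<bar>f x\<bar> powr q) \<partial>lebesgue_on {0<..<1})"
    have Jf: "J < \<infinity>" using assms(1,2) False mem_Lp_iff unfolding J_def q_def by auto
    then have "enn2real J powr (1 / q) \<le> 1"
      using assms(3) False by (auto simp: Lp_norm_def J_def q_def ennreal_le_1 Let_def split: if_splits)
    then have "enn2real J \<le> 1"
      using q powr_mono2[of q "enn2real J powr (1 / q)" 1] by (simp add: powr_powr)
    then have J1: "J \<le> 1" using Jf by (metis ennreal_enn2real ennreal_le_1 infinity_ennreal_def)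
    have "\<bar>f x\<bar> \<le> 1 + \<bar>f x\<bar> powr q" for x
    proof (cases "\<bar>f x\<bar> \<le> 1")
      case False
      then have "\<bar>f x\<bar> powr 1 \<le> \<bar>f x\<bar> powr q" using q by (intro powr_mono) auto
      then show ?thesis using False by simp
    qed (simp add: add_increasing2)
    then have "(\<integral>\<^sup>+ x. ennreal \<bar>f x\<bar> \<partial>lebesgue_on {0<..<1}) 
        \<le> (\<integral>\<^sup>+ x. 1 + ennreal (\<bar>f x\<bar> powr q) \<partial>lebesgue_on {0<..<1})"
      by (intro nn_integral_mono) (metis abs_ge_zero ennreal_1 ennreal_leI ennreal_plus powr_ge_zero zero_le_one)
    also have "\<dots> = 1 + J" by (simp add: nn_integral_add J_def emeasure_restrict_space)
    also have "\<dots> \<le> 1 + 1" using J1 by (intro add_left_mono)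
    finally show ?thesis by simp
  qed
  then have nn: "(\<integral>\<^sup>+ x. ennreal \<bar>f x\<bar> \<partial>lebesgue_on {0<..<1}) \<le> ennreal 2" by simp
  have i: "integrable (lebesgue_on {0<..<1}) f"
    using nn by (intro integrableI_bounded) (auto simp: le_less_trans)
  then show "set_integrable lebesgue {0<..<1} f"
    by (simp add: integrable_restrict_space set_integrable_def)
  have "(LINT x:{0<..<1}|lebesgue. \<bar>f x\<bar>) = (LINT x|lebesgue_on {0<..<1}. \<bar>f x\<bar>)"
    by (simp add: integral_restrict_space set_lebesgue_integral_def)
  also have "\<dots> \<le> 2" 
    using nn i by (subst integral_eq_nn_integral) (auto intro!: enn2real_leI)
  finally show "(LINT x:{0<..<1}|lebesgue. \<bar>f x\<bar>) \<le> 2" .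
qed

text \<open>
  It suffices to give the solution \<open>u\<close> together with its flux \<open>b = a u'\<close> as a first-order system with
  continuous unknowns; the required \<open>W\<^sup>2\<^sup>,\<^sup>p\<close> regularity away from the origin then follows from the
  product rule applied to \<open>u' = a\<^sup>-\<^sup>1 b\<close>.
\<close>

lemma dirichlet_solutionI:
  assumes p: "1 \<le> p" and f: "f \<in> Lp p {0<..<1}"
    and cont: "continuous_on {0<..1} u" "continuous_on {0<..1} b"
    and wu: "has_weak_derivative {0<..<1} u (\<lambda>x. x powr (-2 * \<alpha>) * b x)"
    and wb: "has_weak_derivative {0<..<1} b (\<lambda>x. u x - f x)"
    and bc: "u 1 = 0" "(u \<longlongrightarrow> 0) (at_right 0)"
  shows "dirichlet_solution \<alpha> p f u"
proof -
  define v where "v = (\<lambda>x. x powr (-2 * \<alpha>) * b x)"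
  define v' where "v' = (\<lambda>x. (-2 * \<alpha>) * x powr (-2 * \<alpha> - 1) * b x + x powr (-2 * \<alpha>) * (u x - f x))"
  have sub: "{\<delta><..<1} \<subseteq> {0<..<1::real}" if "0 < \<delta>" for \<delta> using that by auto
  have wv: "has_weak_derivative {0<..<1} v v'" unfolding v_def v'_def
  proof (rule has_weak_derivative_mult[OF open_greaterThanLessThan wb])
    show "((\<lambda>x. x powr (-2 * \<alpha>)) has_real_derivative (-2 * \<alpha>) * x powr (-2 * \<alpha> - 1)) (at x)" 
      if "x \<in> {0<..<1}" for x using that by (intro has_real_derivative_powr) auto
  qed (auto intro!: continuous_intros)
  have bd: "\<exists>B. \<forall>x\<in>{\<delta><..<1}. \<bar>g x\<bar> \<le> B" if "continuous_on {0<..1} g" "0 < \<delta>" for g :: "real \<Rightarrow> real" and \<delta>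
  proof -
    have "compact (g ` {\<delta>..1})" using that
      by (intro compact_continuous_image continuous_on_subset[OF that(1)]) auto
    then obtain B where "\<forall>y\<in>g ` {\<delta>..1}. \<bar>y\<bar> \<le> B" by (metis bounded_real compact_imp_bounded)
    then show ?thesis by (intro exI[of _ B]) auto
  qed
  have ms: "g \<in> borel_measurable (lebesgue_on {\<delta><..<1})" if "continuous_on {0<..1} g" "0 < \<delta>" for g :: "real \<Rightarrow> real" and \<delta>
    by (intro continuous_imp_measurable_on_sets_lebesgue continuous_on_subset[OF that(1)]) (use that in auto)
  have lm: "{\<delta><..<1} \<in> lmeasurable" for \<delta> :: real by (simp add: bounded_set_imp_lmeasurable)
  have cl: "g \<in> Lp p {\<delta><..<1}" if g: "continuous_on {0<..1} g" "0 < \<delta>" for g \<delta>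
    using bd[OF g] bounded_mem_Lp[OF p lm ms[OF g]] by blast
  have cv: "continuous_on {0<..1} v" unfolding v_def by (intro continuous_intros cont) auto
  have "u \<in> W2 p {\<delta><..<1}" if d: "0 < \<delta>" for \<delta>
  proof -
    have fd: "f \<in> Lp p {\<delta><..<1}" using Lp_subset[OF p f sub[OF d]] by simp
    define g where "g = (\<lambda>x::real. - (x powr (-2 * \<alpha>)))"
    define h where "h = (\<lambda>x. (-2 * \<alpha>) * x powr (-2 * \<alpha> - 1) * b x + x powr (-2 * \<alpha>) * u x)"
    have cg: "continuous_on {0<..1} g" "continuous_on {0<..1} h" unfolding g_def h_def
      by (intro continuous_intros cont; simp)+
    obtain A B where AB: "\<And>x. x \<in> {\<delta><..<1} \<Longrightarrow> \<bar>g x\<bar> \<le> A" "\<And>x. x \<in> {\<delta><..<1} \<Longrightarrow> \<bar>h x\<bar> \<le> B"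
      using bd[OF cg(1) d] bd[OF cg(2) d] by blast
    have "v' = (\<lambda>x. g x * f x + h x)" by (auto simp: v'_def g_def h_def fun_eq_iff algebra_simps)
    then have "v' \<in> Lp p {\<delta><..<1}"
      using Lp_affine[OF p fd lm ms[OF cg(1) d] AB(1) ms[OF cg(2) d] AB(2)] by simp
    then have "v \<in> W1 p {\<delta><..<1}"
      using cl[OF cv d] has_weak_derivative_subset[OF wv sub[OF d]] by (auto simp: W1_def)
    then show ?thesis
      using cl[OF cont(1) d] has_weak_derivative_subset[OF wu sub[OF d]] unfolding W2_def v_def[symmetric] by auto
  qed
  then have "u \<in> W2_loc p" using cont by (auto simp: W2_loc_def)
  moreover have "has_weak_derivative {0<..<1} (\<lambda>x. x powr (2 * \<alpha>) * v x) (\<lambda>x. u x - f x)"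
    by (rule has_weak_derivative_cong[OF wb]) (auto simp: v_def powr_minus)
  then have "satisfies_ode \<alpha> f u"
    unfolding satisfies_ode_def using wu by (intro exI[of _ v] exI[of _ "\<lambda>x. u x - f x"]) (auto simp: v_def)
  ultimately show ?thesis using bc by (simp add: dirichlet_solution_def)
qed

section \<open>Solutions of the homogeneous equation\<close>

text \<open>
  Substituting \<open>t = x\<^sup>\<beta>\<close> with \<open>\<beta> = 2 - 2\<alpha>\<close>, and splitting off \<open>x\<^sup>1\<^sup>-\<^sup>2\<^sup>\<alpha>\<close> for the solution that vanishes at the
  origin, turns \<open>(x\<^sup>2\<^sup>\<alpha> u')' = u\<close> into \<open>\<beta> (\<mu> F' + \<beta> t F'') = F\<close>, with \<open>\<mu> = 1\<close> or \<open>\<mu> = 1 - 2\<alpha> + \<beta>\<close>.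
  Its entire solution with \<open>F(0) = 1\<close> is, up to scaling of \<open>t\<close>, the series of a modified Bessel
  function.
\<close>

fun bessel_coeff :: "real \<Rightarrow> real \<Rightarrow> nat \<Rightarrow> real" where
  "bessel_coeff \<beta> \<mu> 0 = 1"
| "bessel_coeff \<beta> \<mu> (Suc k) = bessel_coeff \<beta> \<mu> k / (\<beta> * (real k + 1) * (\<mu> + \<beta> * real k))"

definition bessel_fps :: "real \<Rightarrow> real \<Rightarrow> real fps" where
  "bessel_fps \<beta> \<mu> = Abs_fps (bessel_coeff \<beta> \<mu>)"

lemma bessel_coeff_bounds:
  assumes "1 \<le> \<beta>" "1 \<le> \<mu>"
  shows "0 < bessel_coeff \<beta> \<mu> k \<and> bessel_coeff \<beta> \<mu> k \<le> inverse (fact k)"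
proof (induction k)
  case (Suc k)
  have "real k + 1 \<le> \<beta> * (real k + 1)" using assms by (simp add: mult_le_cancel_right1)
  moreover have "1 \<le> \<mu> + \<beta> * real k" using assms by (simp add: add_increasing2)
  ultimately have D: "real k + 1 \<le> \<beta> * (real k + 1) * (\<mu> + \<beta> * real k)"
    using mult_mono[of "real k + 1" "\<beta> * (real k + 1)" 1 "\<mu> + \<beta> * real k"] assms by simp
  have "bessel_coeff \<beta> \<mu> (Suc k) \<le> inverse (fact k) / (real k + 1)"
    unfolding bessel_coeff.simps using Suc D by (intro frac_le) auto
  also have "\<dots> = inverse (fact (Suc k))" by (simp add: field_simps)
  finally have "bessel_coeff \<beta> \<mu> (Suc k) \<le> inverse (fact (Suc k))" .
  moreover have "0 < bessel_coeff \<beta> \<mu> (Suc k)"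
    unfolding bessel_coeff.simps using Suc D by (intro divide_pos_pos) linarith+
  ultimately show ?case by blast
qed simp

lemma bessel_conv_radius:
  assumes "1 \<le> \<beta>" "1 \<le> \<mu>"
  shows "fps_conv_radius (bessel_fps \<beta> \<mu>) = \<infinity>"
  unfolding fps_conv_radius_def
proof (rule conv_radius_inftyI'')
  fix z :: real
  show "summable (\<lambda>n. fps_nth (bessel_fps \<beta> \<mu>) n * z ^ n)"
  proof (rule summable_comparison_test')
    show "summable (\<lambda>n. inverse (fact n) * \<bar>z\<bar> ^ n)" by (rule summable_exp)
    show "norm (fps_nth (bessel_fps \<beta> \<mu>) n * z ^ n) \<le> inverse (fact n) * \<bar>z\<bar> ^ n" for n
      using bessel_coeff_bounds[OF assms, of n]
      by (auto simp: bessel_fps_def abs_mult power_abs intro!: mult_right_mono)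
  qed
qed

lemma bessel_ode:
  fixes t :: real
  assumes "1 \<le> \<beta>" "1 \<le> \<mu>"
  defines "f \<equiv> bessel_fps \<beta> \<mu>"
  shows "\<beta> * (\<mu> * eval_fps (fps_deriv f) t + \<beta> * t * eval_fps (fps_deriv (fps_deriv f)) t) = eval_fps f t"
proof -
  have R: "fps_conv_radius f = \<infinity>" "fps_conv_radius (fps_deriv f) = \<infinity>" 
      "fps_conv_radius (fps_deriv (fps_deriv f)) = \<infinity>"
    using bessel_conv_radius[OF assms(1,2)] fps_conv_radius_deriv[of f] fps_conv_radius_deriv[of "fps_deriv f"]
    by (auto simp: f_def)
  have fX: "fps_conv_radius (fps_X * fps_deriv (fps_deriv f)) = \<infinity>"
    using fps_conv_radius_mult[of fps_X "fps_deriv (fps_deriv f)"] R by simp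
  have fc: "fps_conv_radius (fps_const c * g) = \<infinity>" if "fps_conv_radius g = \<infinity>" for c :: real and g
    using fps_conv_radius_mult[of "fps_const c" g] that by simp
  have c: "\<beta> * (real n + 1) * (\<mu> + \<beta> * real n) \<noteq> 0" for n
    using assms(1,2) by (smt (verit) mult_nonneg_nonneg mult_pos_pos of_nat_0_le_iff)
  have "f = fps_const (\<beta> * \<mu>) * fps_deriv f + fps_const (\<beta> * \<beta>) * (fps_X * fps_deriv (fps_deriv f))"
    (is "_ = ?g")
  proof (rule fps_ext)
    fix n 
    have "fps_nth ?g n = \<beta> * (real n + 1) * (\<mu> + \<beta> * real n) * bessel_coeff \<beta> \<mu> (Suc n)"
      by (cases n) (simp_all add: f_def bessel_fps_def fps_X_mult_nth algebra_simps del: bessel_coeff.simps)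
    also have "\<dots> = fps_nth f n" using c[of n] by (simp add: f_def bessel_fps_def)
    finally show "fps_nth f n = fps_nth ?g n" by simp
  qed
  then have "eval_fps f t = eval_fps ?g t" by simp
  also have "\<dots> = \<beta> * \<mu> * eval_fps (fps_deriv f) t + \<beta> * \<beta> * (t * eval_fps (fps_deriv (fps_deriv f)) t)"
    using R fX by (simp add: eval_fps_add eval_fps_mult fc)
  finally show ?thesis by (simp add: algebra_simps)
qed

lemma bessel_mono:
  assumes "1 \<le> \<beta>" "1 \<le> \<mu>" "0 \<le> s" "s \<le> t"
  shows "1 \<le> eval_fps (bessel_fps \<beta> \<mu>) s" "eval_fps (bessel_fps \<beta> \<mu>) s \<le> eval_fps (bessel_fps \<beta> \<mu>) t"
proof -
  have sm: "summable (\<lambda>n. fps_nth (bessel_fps \<beta> \<mu>) n * x ^ n)" for x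
    using bessel_conv_radius[OF assms(1,2)] by (intro summable_fps) simp
  have pos: "0 \<le> fps_nth (bessel_fps \<beta> \<mu>) n" for n 
    using bessel_coeff_bounds[OF assms(1,2), of n] by (simp add: bessel_fps_def)
  have mono: "eval_fps (bessel_fps \<beta> \<mu>) s \<le> eval_fps (bessel_fps \<beta> \<mu>) t" if "0 \<le> s" "s \<le> t" for s t
    unfolding eval_fps_def using pos that by (intro suminf_le sm mult_left_mono power_mono) auto
  then show "eval_fps (bessel_fps \<beta> \<mu>) s \<le> eval_fps (bessel_fps \<beta> \<mu>) t" using assms by simp
  have "eval_fps (bessel_fps \<beta> \<mu>) 0 = 1" by (simp add: eval_fps_at_0 bessel_fps_def)
  with mono[of 0 s] assms show "1 \<le> eval_fps (bessel_fps \<beta> \<mu>) s" by simp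
qed

text \<open>
  \<open>\<Phi>\<close> and \<open>Z\<close> are the fluxes \<open>x\<^sup>2\<^sup>\<alpha> \<phi>'\<close> and \<open>x\<^sup>2\<^sup>\<alpha> \<zeta>'\<close>; stating the equation as a first-order system
  avoids differentiating the singular coefficient.
\<close>

locale homogeneous_solutions =
  fixes \<alpha> :: real and \<phi> \<Phi> \<zeta> Z :: "real \<Rightarrow> real" and M :: real
  assumes alpha: "\<alpha> < 1 / 2"
    and phi_deriv: "0 < x \<Longrightarrow> (\<phi> has_real_derivative x powr (-2 * \<alpha>) * \<Phi> x) (at x)"
    and Phi_deriv: "0 < x \<Longrightarrow> (\<Phi> has_real_derivative \<phi> x) (at x)"
    and zeta_deriv: "0 < x \<Longrightarrow> (\<zeta> has_real_derivative x powr (-2 * \<alpha>) * Z x) (at x)"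
    and Zeta_deriv: "0 < x \<Longrightarrow> (Z has_real_derivative \<zeta> x) (at x)"
    and wronskian: "0 < x \<Longrightarrow> \<Phi> x * \<zeta> x - Z x * \<phi> x = 1"
    and phi_cont: "continuous_on {0..} \<phi>" and zeta_cont: "continuous_on {0..} \<zeta>"
    and phi_0: "\<phi> 0 = 0" and zeta_0: "\<zeta> 0 = 1"
    and phi_mono: "0 \<le> x \<Longrightarrow> x \<le> y \<Longrightarrow> \<phi> x \<le> \<phi> y"
    and phi_pos: "0 < x \<Longrightarrow> 0 < \<phi> x"
    and phi_le: "0 < x \<Longrightarrow> x \<le> 1 \<Longrightarrow> \<phi> x \<le> M * x powr (1 - 2 * \<alpha>)"

lemma homogeneous_solutions_exist:
  assumes "\<alpha> < 1 / 2"
  obtains \<phi> \<Phi> \<zeta> Z M where "homogeneous_solutions \<alpha> \<phi> \<Phi> \<zeta> Z M"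
proof -
  define r where "r = 1 - 2 * \<alpha>"
  define \<beta> where "\<beta> = r + 1"
  have r: "0 < r" "1 < \<beta>" "1 \<le> r + \<beta>" using assms by (auto simp: r_def \<beta>_def)
  define f where "f = bessel_fps \<beta> (r + \<beta>)"
  define g where "g = bessel_fps \<beta> 1"
  define F where "F = eval_fps f" 
  define F1 where "F1 = eval_fps (fps_deriv f)" 
  define F2 where "F2 = eval_fps (fps_deriv (fps_deriv f))" 
  define G where "G = eval_fps g" 
  define G1 where "G1 = eval_fps (fps_deriv g)" 
  define G2 where "G2 = eval_fps (fps_deriv (fps_deriv g))" 
  have Rf: "fps_conv_radius f = \<infinity>" and Rg: "fps_conv_radius g = \<infinity>"
    using bessel_conv_radius r by (auto simp: f_def g_def)
  have Rf': "fps_conv_radius (fps_deriv f) = \<infinity>" and Rg': "fps_conv_radius (fps_deriv g) = \<infinity>"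
    using fps_conv_radius_deriv[of f] fps_conv_radius_deriv[of g] Rf Rg by auto
  have D: "(F has_real_derivative F1 t) (at t)" "(F1 has_real_derivative F2 t) (at t)"
          "(G has_real_derivative G1 t) (at t)" "(G1 has_real_derivative G2 t) (at t)" for t
    unfolding F_def F1_def F2_def G_def G1_def G2_def
    by (intro has_field_derivative_eval_fps; simp add: Rf Rg Rf' Rg')+
  have C: "isCont F t" "isCont F1 t" "isCont G t" "isCont G1 t" for t
    using D by (blast intro: DERIV_isCont)+
  have Fode: "\<beta> * ((r + \<beta>) * F1 t + \<beta> * t * F2 t) = F t" for t
    unfolding F_def F1_def F2_def f_def using r by (intro bessel_ode) auto
  have Gode: "\<beta> * (1 * G1 t + \<beta> * t * G2 t) = G t" for t
    unfolding G_def G1_def G2_def g_def using r by (intro bessel_ode) auto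
  have Fmono: "1 \<le> F s" "F s \<le> F t" if "0 \<le> s" "s \<le> t" for s t
    using bessel_mono[of \<beta> "r + \<beta>" s t] r that by (auto simp: F_def f_def)
  have G0: "G 0 = 1" by (simp add: G_def g_def bessel_fps_def eval_fps_at_0)
  have F0: "F 0 = 1" by (simp add: F_def f_def bessel_fps_def eval_fps_at_0)
  define \<phi> where "\<phi> = (\<lambda>x. x powr r * F (x powr \<beta>) / r)"
  define \<Phi> where "\<Phi> = (\<lambda>x. (r * F (x powr \<beta>) + \<beta> * x powr \<beta> * F1 (x powr \<beta>)) / r)"
  define \<zeta> where "\<zeta> = (\<lambda>x. G (x powr \<beta>))"
  define Z where "Z = (\<lambda>x. \<beta> * x * G1 (x powr \<beta>))"
  have pD: "((\<lambda>x. x powr \<beta>) has_real_derivative \<beta> * x powr r) (at x)" if "0 < x" for x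
    using has_real_derivative_powr[OF that, of \<beta>] by (simp add: \<beta>_def)
  have pr: "((\<lambda>x. x powr r) has_real_derivative r * x powr (r - 1)) (at x)" if "0 < x" for x
    by (rule has_real_derivative_powr[OF that])
  note chain = DERIV_chain2[OF D(1) pD] DERIV_chain2[OF D(2) pD] DERIV_chain2[OF D(3) pD] DERIV_chain2[OF D(4) pD]
  have powers: "x powr r = x powr (r - 1) * x" "x powr \<beta> = x powr (r - 1) * x * x" if "0 < x" for x
    using that by (auto simp: \<beta>_def powr_diff powr_add)
  have d1: "(\<phi> has_real_derivative x powr (-2 * \<alpha>) * \<Phi> x) (at x)" if x: "0 < x" for x
  proof -
    have e: "x powr (-2 * \<alpha>) = x powr (r - 1)" by (simp add: r_def)
    have q: "x powr r * x powr r = x powr \<beta> * x powr (r - 1)" 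
      by (simp add: \<beta>_def flip: powr_add)
    show ?thesis unfolding \<phi>_def \<Phi>_def e
      by (rule derivative_eq_intros chain(1) pr x refl)+
         (use r in simp, use r in \<open>simp add: field_simps\<close>, use q in algebra)
  qed
  have d2: "(\<Phi> has_real_derivative \<phi> x) (at x)" if x: "0 < x" for x
  proof -
    let ?t = "x powr \<beta>"
    have e: "\<phi> x = x powr r * (\<beta> * ((r + \<beta>) * F1 ?t + \<beta> * ?t * F2 ?t)) / r"
      by (simp add: \<phi>_def Fode)
    have q: "x powr (\<beta> - 1) = x powr r" by (simp add: \<beta>_def)
    show ?thesis unfolding e unfolding \<Phi>_def
      by (rule derivative_eq_intros chain(1,2) pD pr x refl)+
         (use r in \<open>simp_all add: q field_simps\<close>)
  qed
  have d3: "(\<zeta> has_real_derivative x powr (-2 * \<alpha>) * Z x) (at x)" if x: "0 < x" for x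
  proof -
    have e: "x powr (-2 * \<alpha>) = x powr (r - 1)" by (simp add: r_def)
    show ?thesis unfolding \<zeta>_def Z_def e
      by (rule DERIV_cong[OF chain(3)[OF x]]) (simp add: powers[OF x])
  qed
  have d4: "(Z has_real_derivative \<zeta> x) (at x)" if x: "0 < x" for x
  proof -
    let ?t = "x powr \<beta>"
    have e: "\<zeta> x = \<beta> * (1 * G1 ?t + \<beta> * ?t * G2 ?t)"
      using Gode[of ?t] by (simp add: \<zeta>_def)
    show ?thesis unfolding e unfolding Z_def
      by (rule DERIV_cong[OF DERIV_mult[OF DERIV_cmult_Id chain(4)[OF x]]]) 
         (simp add: powers[OF x] algebra_simps)
  qed
  have cp: "continuous_on {0..} (\<lambda>x. x powr \<beta>)" "continuous_on {0..} (\<lambda>x. x powr r)"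
    by (rule continuous_on_powr'; use r in \<open>auto intro!: continuous_intros\<close>)+
  have cc: "continuous_on A F" "continuous_on A F1" "continuous_on A G" "continuous_on A G1" for A
    using C by (auto simp: continuous_at_imp_continuous_on)
  note comp = cc[THEN continuous_on_compose2, OF cp(1) subset_refl]
  have c1: "continuous_on {0..} \<phi>" unfolding \<phi>_def by (intro continuous_intros comp cp) (use r in auto)
  have c2: "continuous_on {0..} \<zeta>" unfolding \<zeta>_def by (intro continuous_intros comp cp)
  have c3: "continuous_on {0..} \<Phi>" unfolding \<Phi>_def by (intro continuous_intros comp cp) (use r in auto)
  have c4: "continuous_on {0..} Z" unfolding Z_def by (intro continuous_intros comp cp)
  have wr: "\<Phi> x * \<zeta> x - Z x * \<phi> x = 1" if x: "0 < x" for x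
  proof -
    define w where "w = (\<lambda>x. \<Phi> x * \<zeta> x - Z x * \<phi> x)"
    \<comment> \<open>The Wronskian is constant and, the fluxes being continuous up to \<open>0\<close>, can be read off there.\<close>
    have "w x = w 0"
    proof (rule DERIV_isconst2[of 0 x])
      show "continuous_on {0..x} w" unfolding w_def
        by (intro continuous_intros continuous_on_subset[OF c1] continuous_on_subset[OF c2]
              continuous_on_subset[OF c3] continuous_on_subset[OF c4]) auto
      show "(w has_real_derivative 0) (at y)" if "0 < y" "y < x" for y
        unfolding w_def 
        by (rule derivative_eq_intros d1 d2 d3 d4 that refl)+ (simp add: algebra_simps)
    qed (use x in auto)
    also have "w 0 = 1" using r by (simp add: w_def \<Phi>_def \<zeta>_def \<phi>_def G0 F0)
    finally show ?thesis by (simp add: w_def)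
  qed
  have "homogeneous_solutions \<alpha> \<phi> \<Phi> \<zeta> Z (F 1 / r)"
  proof
    show "\<phi> x \<le> \<phi> y" if "0 \<le> x" "x \<le> y" for x y
      unfolding \<phi>_def using Fmono[of "x powr \<beta>" "y powr \<beta>"] powr_mono2[of \<beta> x y] that r
      by (intro divide_right_mono mult_mono powr_mono2) auto
    show "0 < \<phi> x" if "0 < x" for x
      using Fmono(1)[of "x powr \<beta>" "x powr \<beta>"] that r by (simp add: \<phi>_def)
    show "\<phi> x \<le> F 1 / r * x powr (1 - 2 * \<alpha>)" if "0 < x" "x \<le> 1" for x
    proof -
      have "F (x powr \<beta>) \<le> F 1" using that r powr_mono2[of \<beta> x 1] by (intro Fmono) auto
      then have "x powr r * F (x powr \<beta>) / r \<le> x powr r * F 1 / r"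
        using r by (intro divide_right_mono mult_left_mono) auto
      then show ?thesis by (simp add: \<phi>_def r_def mult.commute)
    qed
  qed (use assms d1 d2 d3 d4 wr c1 c2 r G0 in \<open>auto simp: \<phi>_def \<zeta>_def\<close>)
  then show thesis using that by blast
qed

section \<open>Uniqueness\<close>

text \<open>
  Densities for duality arguments. No smoothness is asked, so that a bump may contain as a factor the
  merely continuous function that is tested.
\<close>

definition bumps :: "(real \<Rightarrow> real) set" where
  "bumps = {\<rho>. continuous_on UNIV \<rho> \<and> (\<exists>c d. 0 < c \<and> c \<le> d \<and> d < 1 \<and> (\<forall>x. x \<notin> {c..d} \<longrightarrow> \<rho> x = 0))}"

lemma bumps_lincomb:
  assumes "\<rho> \<in> bumps" "\<sigma> \<in> bumps"
  shows "(\<lambda>x. \<rho> x - k * \<sigma> x) \<in> bumps"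
proof -
  obtain c d c' d' where *: "0 < c" "c \<le> d" "d < 1" "\<And>x. x \<notin> {c..d} \<Longrightarrow> \<rho> x = 0"
    "0 < c'" "c' \<le> d'" "d' < 1" "\<And>x. x \<notin> {c'..d'} \<Longrightarrow> \<sigma> x = 0"
    "continuous_on UNIV \<rho>" "continuous_on UNIV \<sigma>"
    using assms unfolding bumps_def by blast
  have "\<forall>x. x \<notin> {min c c'..max d d'} \<longrightarrow> \<rho> x - k * \<sigma> x = 0"
  proof safe
    fix x assume "x \<notin> {min c c'..max d d'}"
    then have "x \<notin> {c..d}" "x \<notin> {c'..d'}" by auto
    then show "\<rho> x - k * \<sigma> x = 0" using *(4,8) by simp
  qed
  moreover have "0 < min c c'" "min c c' \<le> max d d'" "max d d' < 1" using * by auto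
  moreover have "continuous_on UNIV (\<lambda>x. \<rho> x - k * \<sigma> x)" by (intro continuous_intros *)
  ultimately show ?thesis unfolding bumps_def by blast
qed

lemma integrable_times_bump:
  assumes "continuous_on {0<..<1} q" "\<rho> \<in> bumps"
  shows "integrable lebesgue (\<lambda>x. q x * \<rho> x)"
proof -
  obtain c d where *: "0 < c" "d < 1" "\<And>x. x \<notin> {c..d} \<Longrightarrow> \<rho> x = 0" "continuous_on UNIV \<rho>"
    using assms(2) unfolding bumps_def by blast
  show ?thesis
    by (rule locally_integrable_times_compact[OF locally_integrable_continuous[OF assms(1)], of "{c..d}"])
      (use * in \<open>auto intro: continuous_on_subset\<close>)
qed

text \<open>
  Testing with \<open>q\<close> itself, localised by a hat function \<open>T\<close>, makes the integrand \<open>q\<^sup>2 T\<close> nonnegative.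
\<close>

lemma zero_of_bumps:
  assumes q: "continuous_on {0<..<1} q" and z: "\<And>\<rho>. \<rho> \<in> bumps \<Longrightarrow> (LINT x|lebesgue. q x * \<rho> x) = 0"
    and x0: "x0 \<in> {0<..<1}"
  shows "q x0 = 0"
proof -
  define e where "e = min x0 (1 - x0) / 2"
  have e: "0 < e" "0 < x0 - e" "x0 + e < 1" using x0 by (auto simp: e_def min_def field_simps)
  define T where "T = (\<lambda>x. max 0 (e - \<bar>x - x0\<bar>))"
  define \<rho> where "\<rho> = (\<lambda>x. if x \<in> {0<..<1} then q x * T x else 0)"
  have T0: "T x = 0" if "x \<notin> {x0 - e..x0 + e}" for x using that by (auto simp: T_def abs_if max_def split: if_splits)
  have r0: "\<rho> x = 0" if "x \<notin> {x0 - e..x0 + e}" for x using T0[OF that] by (simp add: \<rho>_def)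
  have "continuous_on ({0<..<1} \<union> - {x0 - e..x0 + e}) \<rho>"
  proof (rule continuous_on_open_Un)
    have "continuous_on {0<..<1} (\<lambda>x. q x * T x)" unfolding T_def by (intro continuous_intros q)
    then show "continuous_on {0<..<1} \<rho>" by (rule continuous_on_eq) (simp add: \<rho>_def)
    show "continuous_on (- {x0 - e..x0 + e}) \<rho>"
      by (rule continuous_on_eq[of _ "\<lambda>_. 0"]) (auto simp: r0)
  qed auto
  moreover have "{0<..<1} \<union> - {x0 - e..x0 + e} = UNIV" using e by auto
  ultimately have cr: "continuous_on UNIV \<rho>" by simp
  have "0 < x0 - e \<and> x0 - e \<le> x0 + e \<and> x0 + e < 1 \<and> (\<forall>x. x \<notin> {x0 - e..x0 + e} \<longrightarrow> \<rho> x = 0)" using e r0 by simp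
  then have "\<rho> \<in> bumps" using cr unfolding bumps_def by blast
  then have "0 = (LINT x|lebesgue. q x * \<rho> x)" using z by simp
  also have "\<dots> = (LINT x:{x0 - e..x0 + e}|lebesgue. q x * \<rho> x)"
    unfolding set_lebesgue_integral_def using r0 by (intro Bochner_Integration.integral_cong) (auto simp: indicator_def)
  also have "\<dots> = integral {x0 - e..x0 + e} (\<lambda>x. q x * \<rho> x)"
    by (intro set_lebesgue_integral_eq_integral absolutely_integrable_continuous_real continuous_intros
        continuous_on_subset[OF q] continuous_on_subset[OF cr]) (use e in auto)
  finally have "integral {x0 - e..x0 + e} (\<lambda>x. q x * \<rho> x) = 0" by simp
  moreover have "continuous_on {x0 - e..x0 + e} (\<lambda>x. q x * \<rho> x)"
    by (intro continuous_intros continuous_on_subset[OF q] continuous_on_subset[OF cr]) (use e in auto)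
  moreover have "0 \<le> q x * \<rho> x" for x by (auto simp: \<rho>_def T_def simp flip: mult.assoc)
  ultimately have "\<forall>x\<in>{x0 - e..x0 + e}. q x * \<rho> x = 0"
    using integral_eq_0_iff[of "x0 - e" "x0 + e" "\<lambda>x. q x * \<rho> x"] e by simp
  then have "q x0 * \<rho> x0 = 0" using e by auto
  then show ?thesis using x0 e by (auto simp: \<rho>_def T_def)
qed

context homogeneous_solutions
begin

lemma continuous_solutions:
  assumes "S \<subseteq> {0..}"
  shows "continuous_on S \<phi>" "continuous_on S \<zeta>"
  using assms phi_cont zeta_cont continuous_on_subset by blast+

lemma continuous_fluxes:
  assumes "S \<subseteq> {0<..}"
  shows "continuous_on S \<Phi>" "continuous_on S Z"
proof -
  have "x \<in> S \<Longrightarrow> 0 < x" for x using assms by auto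
  then show "continuous_on S \<Phi>" "continuous_on S Z"
    by (auto intro!: DERIV_continuous_on has_field_derivative_at_within[OF Phi_deriv]
          has_field_derivative_at_within[OF Zeta_deriv])
qed

text \<open>
  Mean zero is what keeps the primitive of \<open>g \<rho>\<close> compactly supported in \<open>(0,1)\<close>; this makes
  functions built from it by variation of parameters admissible as test functions.
\<close>

lemma primitive_of_bump:
  assumes g: "continuous_on {0..} g" and r: "\<rho> \<in> bumps" and z: "(LINT x|lebesgue. g x * \<rho> x) = 0"
  defines "P \<equiv> \<lambda>x. integral {0..x} (\<lambda>t. g t * \<rho> t)"
  shows "\<And>x. x \<in> {0<..<1} \<Longrightarrow> (P has_real_derivative g x * \<rho> x) (at x)"
    and "\<exists>c d. 0 < c \<and> d < 1 \<and> (\<forall>x\<in>{0<..<1}. x \<notin> {c..d} \<longrightarrow> P x = 0)"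
proof -
  obtain c d where cd: "0 < c" "c \<le> d" "d < 1" "\<And>x. x \<notin> {c..d} \<Longrightarrow> \<rho> x = 0" "continuous_on UNIV \<rho>"
    using r unfolding bumps_def by blast
  have c: "continuous_on {0..1} (\<lambda>t. g t * \<rho> t)"
    by (intro continuous_intros continuous_on_subset[OF g] continuous_on_subset[OF cd(5)]) auto
  show "(P has_real_derivative g x * \<rho> x) (at x)" if "x \<in> {0<..<1}" for x
  proof -
    have "(P has_real_derivative g x * \<rho> x) (at x within {0..1})"
      unfolding P_def using that by (intro integral_has_real_derivative[OF c]) auto
    then show ?thesis using that at_within_Icc_at[of 0 x 1] by auto
  qed
  have I: "integral {0..1} (\<lambda>t. g t * \<rho> t) = 0"
  proof -
    have "(LINT x|lebesgue. g x * \<rho> x) = (LINT x:{0..1}|lebesgue. g x * \<rho> x)" 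
    proof -
      have "\<rho> x = 0" if "x \<notin> {0..1}" for x
      proof (rule cd(4))
        show "x \<notin> {c..d}" using that cd(1,3) by auto
      qed
      then show ?thesis unfolding set_lebesgue_integral_def
        by (intro Bochner_Integration.integral_cong) (auto simp: indicator_def)
    qed
    also have "\<dots> = integral {0..1} (\<lambda>t. g t * \<rho> t)"
      by (intro set_lebesgue_integral_eq_integral absolutely_integrable_continuous_real c)
    finally show ?thesis using z by simp
  qed
  have "P x = 0" if x: "x \<in> {0<..<1}" "x \<notin> {c..d}" for x
  proof (cases "x < c")
    case True
    have "g t * \<rho> t = 0" if "t \<in> {0..x}" for t
    proof -
      have "t \<notin> {c..d}" using that True by auto
      then show ?thesis using cd(4) by simp
    qed
    then show ?thesis unfolding P_def by (intro integral_unique has_integral_is_0)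
  next
    case False
    then have xd: "d < x" using x by auto
    have "P x + integral {x..1} (\<lambda>t. g t * \<rho> t) = integral {0..1} (\<lambda>t. g t * \<rho> t)"
      unfolding P_def using x integrable_continuous_real[OF c]
      by (intro Henstock_Kurzweil_Integration.integral_combine) auto
    moreover have "integral {x..1} (\<lambda>t. g t * \<rho> t) = 0"
    proof (intro integral_unique has_integral_is_0)
      fix t assume "t \<in> {x..1}"
      then have "t \<notin> {c..d}" using xd by auto
      then show "g t * \<rho> t = 0" using cd(4) by simp
    qed
    ultimately show ?thesis using I by simp
  qed
  then show "\<exists>c d. 0 < c \<and> d < 1 \<and> (\<forall>x\<in>{0<..<1}. x \<notin> {c..d} \<longrightarrow> P x = 0)"
    using cd by blast
qed

text \<open>
  Both derivatives are moved to the test function. The first integration by parts needs the flux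
  \<open>\<theta> = a \<eta>'\<close> itself to be a test function.
\<close>

lemma very_weak_formulation:
  assumes z: "has_weak_derivative {0<..<1} z v"
    and w: "has_weak_derivative {0<..<1} (\<lambda>x. x powr (2 * \<alpha>) * v x) w"
    and ae: "AE x in lebesgue_on {0<..<1}. w x = z x"
    and t: "\<eta> \<in> test_functions {0<..<1}" "\<theta> \<in> test_functions {0<..<1}"
    and th: "\<And>x. x \<in> {0<..<1} \<Longrightarrow> \<theta> x = x powr (2 * \<alpha>) * deriv \<eta> x"
  shows "(LINT x|lebesgue. z x * deriv \<theta> x) = (LINT x|lebesgue. z x * \<eta> x)"
proof -
  let ?I = "{0<..<1::real}"
  have "(LINT x|lebesgue. z x * deriv \<theta> x) = - (LINT x|lebesgue. v x * \<theta> x)"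
    using z t(2) unfolding weak_derivative_iff[OF open_greaterThanLessThan] by blast
  also have "(LINT x|lebesgue. v x * \<theta> x) = (LINT x|lebesgue. x powr (2 * \<alpha>) * v x * deriv \<eta> x)"
  proof (intro Bochner_Integration.integral_cong refl)
    fix x show "v x * \<theta> x = x powr (2 * \<alpha>) * v x * deriv \<eta> x"
    proof (cases "x \<in> ?I")
      case False
      then have "\<theta> x = 0" "deriv \<eta> x = 0" using test_function_support[OF t(1)] test_function_support[OF t(2)] by blast+
      then show ?thesis by simp
    qed (simp add: th)
  qed
  also have "\<dots> = - (LINT x|lebesgue. w x * \<eta> x)"
    using w t(1) unfolding weak_derivative_iff[OF open_greaterThanLessThan] by blast
  also have "(LINT x|lebesgue. w x * \<eta> x) = (LINT x|lebesgue. z x * \<eta> x)"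
  proof (rule integral_cong_AE)
    obtain K where "compact K \<and> K \<subseteq> ?I \<and> (\<forall>x. x \<notin> K \<longrightarrow> \<eta> x = 0 \<and> deriv \<eta> x = 0)"
      using test_function_support[OF t(1)] by blast
    then have K: "compact K" "K \<subseteq> ?I" "\<And>x. x \<notin> K \<Longrightarrow> \<eta> x = 0" by auto
    have l: "locally_integrable ?I w" "locally_integrable ?I z" using z w by (auto simp: has_weak_derivative_def)
    note i = locally_integrable_times_compact[OF _ K(1,2) test_function_derivative(2)[OF t(1)] K(3), THEN borel_measurable_integrable]
    show "(\<lambda>x. w x * \<eta> x) \<in> borel_measurable lebesgue" "(\<lambda>x. z x * \<eta> x) \<in> borel_measurable lebesgue"
      using i[OF l(1)] i[OF l(2)] by auto
    have "AE x in lebesgue. x \<in> ?I \<longrightarrow> w x = z x" using ae by (simp add: AE_restrict_space_iff)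
    then show "AE x in lebesgue. w x * \<eta> x = z x * \<eta> x"
    proof eventually_elim
      case (elim x)
      show ?case
      proof (cases "x \<in> ?I")
        case False
        then have "x \<notin> K" using K(2) by blast
        then show ?thesis using K(3) by simp
      qed (use elim in simp)
    qed
  qed
  finally show ?thesis by simp
qed

text \<open>
  Variation of parameters produces \<open>\<eta>\<close> with \<open>(a \<eta>')' = \<eta> - \<rho>\<close> and \<open>\<eta> = 0\<close> near \<open>0\<close>; orthogonality of \<open>\<rho>\<close> to
  \<open>\<phi>\<close> and \<open>\<zeta>\<close> makes it vanish near \<open>1\<close> too. Inserting it in the very weak formulation
  leaves \<open>\<integral> z \<rho> = 0\<close>.
\<close>

lemma orthogonal_to_bumps:
  assumes cz: "continuous_on {0<..<1} z"
    and z: "has_weak_derivative {0<..<1} z v"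
    and w: "has_weak_derivative {0<..<1} (\<lambda>x. x powr (2 * \<alpha>) * v x) w"
    and ae: "AE x in lebesgue_on {0<..<1}. w x = z x"
    and r: "\<rho> \<in> bumps" "(LINT x|lebesgue. \<phi> x * \<rho> x) = 0" "(LINT x|lebesgue. \<zeta> x * \<rho> x) = 0"
  shows "(LINT x|lebesgue. z x * \<rho> x) = 0"
proof -
  let ?I = "{0<..<1::real}"
  define P where "P x = integral {0..x} (\<lambda>t. \<phi> t * \<rho> t)" for x
  define Q where "Q x = integral {0..x} (\<lambda>t. \<zeta> t * \<rho> t)" for x
  note P = primitive_of_bump[OF phi_cont r(1,2), folded P_def]
  note Q = primitive_of_bump[OF zeta_cont r(1,3), folded Q_def]
  obtain c d where cd: "0 < c \<and> d < 1 \<and> (\<forall>x\<in>?I. x \<notin> {c..d} \<longrightarrow> P x = 0)" using P(2) by (elim exE)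
  obtain c' d' where cd': "0 < c' \<and> d' < 1 \<and> (\<forall>x\<in>?I. x \<notin> {c'..d'} \<longrightarrow> Q x = 0)" using Q(2) by (elim exE)
  define K where "K = {min c c'..max d d'}"
  have K: "compact K" "K \<subseteq> ?I" using cd cd' by (auto simp: K_def)
  have out: "P x = 0" "Q x = 0" if "x \<in> ?I" "x \<notin> K" for x 
  proof -
    have "x \<notin> {c..d}" "x \<notin> {c'..d'}" using that(2) by (auto simp: K_def)
    then show "P x = 0" "Q x = 0" using cd cd' that(1) by blast+
  qed
  have "continuous_on UNIV \<rho>" using r(1) by (simp add: bumps_def)
  then have cr: "continuous_on S \<rho>" for S by (rule continuous_on_subset) simp
  have cPQ: "continuous_on ?I P" "continuous_on ?I Q"
    by (rule DERIV_continuous_on has_field_derivative_at_within[OF P(1)] has_field_derivative_at_within[OF Q(1)] | assumption)+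
  note cs = continuous_solutions[of ?I] continuous_fluxes[of ?I]
  define g where "g = (\<lambda>x. \<zeta> x * P x - \<phi> x * Q x)"
  define h where "h = (\<lambda>x. Z x * P x - \<Phi> x * Q x)"
  have dg: "(g has_real_derivative x powr (-2 * \<alpha>) * h x) (at x)" if x: "x \<in> ?I" for x
    unfolding g_def h_def using x
    by (auto intro!: derivative_eq_intros P(1) Q(1) phi_deriv zeta_deriv simp: algebra_simps)
  have dh: "(h has_real_derivative g x - \<rho> x) (at x)" if x: "x \<in> ?I" for x
  proof -
    have "(h has_real_derivative \<zeta> x * P x + \<phi> x * \<rho> x * Z x - (\<phi> x * Q x + \<zeta> x * \<rho> x * \<Phi> x)) (at x)"
      unfolding h_def using x
      by (intro DERIV_diff DERIV_mult P(1) Q(1) Phi_deriv Zeta_deriv) auto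
    moreover have "\<zeta> x * P x + \<phi> x * \<rho> x * Z x - (\<phi> x * Q x + \<zeta> x * \<rho> x * \<Phi> x) = g x - \<rho> x"
      using wronskian[of x] x unfolding g_def by (simp, algebra)
    ultimately show ?thesis by simp
  qed
  have cg: "continuous_on ?I g" "continuous_on ?I h" unfolding g_def h_def
    by (intro continuous_intros cPQ cs; force)+
  have cg': "continuous_on ?I (\<lambda>x. x powr (-2 * \<alpha>) * h x)" "continuous_on ?I (\<lambda>x. g x - \<rho> x)"
    by (intro continuous_intros cg cr; simp)+
  define \<eta> where "\<eta> = (\<lambda>x. if x \<in> ?I then g x else 0)"
  define \<theta> where "\<theta> = (\<lambda>x. if x \<in> ?I then h x else 0)"
  have te: "\<eta> \<in> test_functions ?I" "\<And>x. x \<in> ?I \<Longrightarrow> deriv \<eta> x = x powr (-2 * \<alpha>) * h x"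
    unfolding \<eta>_def using test_functionI[OF open_greaterThanLessThan K dg cg'(1)] out by (auto simp: g_def)
  have tt: "\<theta> \<in> test_functions ?I" "\<And>x. x \<in> ?I \<Longrightarrow> deriv \<theta> x = g x - \<rho> x"
    unfolding \<theta>_def using test_functionI[OF open_greaterThanLessThan K dh cg'(2)] out by (auto simp: h_def)
  have "(LINT x|lebesgue. z x * deriv \<theta> x) = (LINT x|lebesgue. z x * \<eta> x)"
    by (rule very_weak_formulation[OF z w ae te(1) tt(1)])
      (simp add: te(2) \<theta>_def powr_minus)
  also have "(\<lambda>x. z x * deriv \<theta> x) = (\<lambda>x. z x * \<eta> x - z x * \<rho> x)"
  proof
    fix x show "z x * deriv \<theta> x = z x * \<eta> x - z x * \<rho> x"
    proof (cases "x \<in> ?I")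
      case False
      have "deriv \<theta> x = 0" using False test_function_support[OF tt(1)] by blast
      moreover have "\<eta> x = 0" using False by (auto simp: \<eta>_def)
      moreover have "\<rho> x = 0" using False r(1) by (auto simp: bumps_def)
      ultimately show ?thesis by simp
    qed (simp add: tt(2) \<eta>_def algebra_simps)
  qed
  also have "(LINT x|lebesgue. z x * \<eta> x - z x * \<rho> x) = (LINT x|lebesgue. z x * \<eta> x) - (LINT x|lebesgue. z x * \<rho> x)"
  proof (rule Bochner_Integration.integral_diff[OF _ integrable_times_bump[OF cz r(1)]])
    show "integrable lebesgue (\<lambda>x. z x * \<eta> x)"
      by (rule locally_integrable_times_compact[OF locally_integrable_continuous[OF cz] K test_function_derivative(2)[OF te(1)]])
        (use out in \<open>auto simp: \<eta>_def g_def\<close>)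
  qed
  finally show ?thesis by simp
qed

text \<open>
  Linear algebra on functionals: one that vanishes on the common kernel of two others is a combination
  of them. The second functional is \<open>\<zeta> - k \<phi>\<close>, with \<open>k\<close> chosen so that it vanishes at \<open>\<rho>\<^sub>1\<close>; this makes the
  system for the coefficients triangular. It is not the zero functional, since \<open>\<phi>(0) = 0\<close> and
  \<open>\<zeta>(0) = 1\<close>.
\<close>

lemma very_weak_solution_span:
  assumes cz: "continuous_on {0<..<1} z"
    and orth: "\<And>\<rho>. \<rho> \<in> bumps \<Longrightarrow> (LINT x|lebesgue. \<phi> x * \<rho> x) = 0 \<Longrightarrow> (LINT x|lebesgue. \<zeta> x * \<rho> x) = 0 \<Longrightarrow> 
      (LINT x|lebesgue. z x * \<rho> x) = 0"
  shows "\<exists>A B k. \<forall>x\<in>{0<..<1}. z x = A * \<phi> x + B * (\<zeta> x - k * \<phi> x)"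
proof -
  let ?I = "{0<..<1::real}"
  define L where "L = (\<lambda>(g::real\<Rightarrow>real) \<rho>. LINT x|lebesgue. g x * \<rho> x)"
  have c: "continuous_on ?I \<phi>" "continuous_on ?I \<zeta>" by (intro continuous_solutions; force)+
  have lin1: "L (\<lambda>x. g x - k * h x) \<rho> = L g \<rho> - k * L h \<rho>"
    if "\<rho> \<in> bumps" "continuous_on ?I g" "continuous_on ?I h" for g h \<rho> k
    using integrable_times_bump[OF that(2,1)] integrable_times_bump[OF that(3,1)]
    by (simp add: L_def left_diff_distrib mult.assoc)
  have lin2: "L g (\<lambda>x. \<rho> x - k * \<sigma> x) = L g \<rho> - k * L g \<sigma>"
    if "\<rho> \<in> bumps" "\<sigma> \<in> bumps" "continuous_on ?I g" for g \<rho> \<sigma> k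
    using integrable_times_bump[OF that(3,1)] integrable_times_bump[OF that(3,2)]
    by (simp add: L_def right_diff_distrib mult.left_commute)
  have nz: "\<exists>\<rho>\<in>bumps. L g \<rho> \<noteq> 0" if "continuous_on ?I g" "x \<in> ?I" "g x \<noteq> 0" for g x
    using zero_of_bumps[OF that(1) _ that(2)] that(3) unfolding L_def by blast
  obtain \<rho>\<^sub>1 where r1: "\<rho>\<^sub>1 \<in> bumps" "L \<phi> \<rho>\<^sub>1 \<noteq> 0"
    using nz[OF c(1), of "1/2"] phi_pos[of "1/2"] by auto
  define k where "k = L \<zeta> \<rho>\<^sub>1 / L \<phi> \<rho>\<^sub>1"
  define \<omega> where "\<omega> = (\<lambda>x. \<zeta> x - k * \<phi> x)"
  have co: "continuous_on ?I \<omega>" unfolding \<omega>_def by (intro continuous_intros c)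
  have w1: "L \<omega> \<rho>\<^sub>1 = 0" unfolding \<omega>_def lin1[OF r1(1) c(2,1)] using r1 by (simp add: k_def)
  have "\<exists>x\<in>?I. \<omega> x \<noteq> 0"
  proof (rule ccontr)
    assume "\<not> ?thesis"
    then have "continuous_on {0..1} \<omega> \<and> (\<forall>x\<in>?I. \<omega> x = 0)"
      unfolding \<omega>_def by (auto intro!: continuous_intros continuous_solutions)
    then have "\<omega> 0 = 0"
      using continuous_constant_on_closure[of ?I \<omega> 0 0] by simp
    then show False by (simp add: \<omega>_def phi_0 zeta_0)
  qed
  then obtain \<rho>\<^sub>2 where r2: "\<rho>\<^sub>2 \<in> bumps" "L \<omega> \<rho>\<^sub>2 \<noteq> 0" using nz[OF co] by blast
  define B where "B = (L z \<rho>\<^sub>2 - L z \<rho>\<^sub>1 * (L \<phi> \<rho>\<^sub>2 / L \<phi> \<rho>\<^sub>1)) / L \<omega> \<rho>\<^sub>2"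
  define A where "A = L z \<rho>\<^sub>1 / L \<phi> \<rho>\<^sub>1"
  define q where "q = (\<lambda>x. (z x - A * \<phi> x) - B * \<omega> x)"
  have c1: "continuous_on ?I (\<lambda>x. z x - A * \<phi> x)" by (intro continuous_intros c cz)
  have cq: "continuous_on ?I q" unfolding q_def by (intro continuous_intros c1 co)
  have "L q \<rho> = 0" if r: "\<rho> \<in> bumps" for \<rho>
  proof -
    define t where "t = L \<omega> \<rho> / L \<omega> \<rho>\<^sub>2"
    define s where "s = (L \<phi> \<rho> - t * L \<phi> \<rho>\<^sub>2) / L \<phi> \<rho>\<^sub>1"
    define \<rho>' where "\<rho>' = (\<lambda>x. \<rho> x - t * \<rho>\<^sub>2 x)"
    have r': "\<rho>' \<in> bumps" unfolding \<rho>'_def using bumps_lincomb r r2 by blast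
    define \<rho>'' where "\<rho>'' = (\<lambda>x. \<rho>' x - s * \<rho>\<^sub>1 x)"
    have r'': "\<rho>'' \<in> bumps" unfolding \<rho>''_def using bumps_lincomb r' r1 by blast
    have L2: "L g \<rho>'' = L g \<rho> - t * L g \<rho>\<^sub>2 - s * L g \<rho>\<^sub>1" if "continuous_on ?I g" for g
      unfolding \<rho>''_def lin2[OF r' r1(1) that] unfolding \<rho>'_def lin2[OF r r2(1) that] ..
    have 1: "L \<phi> \<rho>'' = 0" using r1 by (simp add: L2 c s_def)
    have 2: "L \<omega> \<rho>'' = 0" using r2 by (simp add: L2 co w1 t_def)
    have "L \<zeta> \<rho>'' = 0" using 1 2 lin1[OF r'' c(2,1), of k] by (simp add: \<omega>_def)
    then have "L z \<rho>'' = 0" using orth[OF r''] 1 by (simp add: L_def)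
    then have "L z \<rho> = t * L z \<rho>\<^sub>2 + s * L z \<rho>\<^sub>1" by (simp add: L2 cz)
    moreover have "L q \<rho> = L z \<rho> - A * L \<phi> \<rho> - B * L \<omega> \<rho>"
      unfolding q_def lin1[OF r c1 co] lin1[OF r cz c(1)] ..
    moreover have "L \<phi> \<rho> = s * L \<phi> \<rho>\<^sub>1 + t * L \<phi> \<rho>\<^sub>2" "L \<omega> \<rho> = t * L \<omega> \<rho>\<^sub>2"
      using r1(2) r2(2) by (simp_all add: s_def t_def)
    moreover have "A * L \<phi> \<rho>\<^sub>1 = L z \<rho>\<^sub>1" "B * L \<omega> \<rho>\<^sub>2 = L z \<rho>\<^sub>2 - A * L \<phi> \<rho>\<^sub>2"
      using r1(2) r2(2) by (simp_all add: A_def B_def)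
    ultimately show "L q \<rho> = 0" by algebra
  qed
  then have "q x = 0" if "x \<in> ?I" for x using zero_of_bumps[OF cq _ that] by (simp add: L_def)
  then have "\<forall>x\<in>?I. z x = A * \<phi> x + B * (\<zeta> x - k * \<phi> x)" 
    unfolding q_def \<omega>_def by (smt (verit))
  then show ?thesis by blast
qed

text \<open>
  The limit at \<open>0\<close> removes the part along \<open>\<zeta>\<close>, the value at \<open>1\<close> the part along \<open>\<phi>\<close>.
\<close>

lemma homogeneous_dirichlet_zero:
  assumes cz: "continuous_on {0<..1} z"
    and z: "has_weak_derivative {0<..<1} z v"
    and w: "has_weak_derivative {0<..<1} (\<lambda>x. x powr (2 * \<alpha>) * v x) w"
    and ae: "AE x in lebesgue_on {0<..<1}. w x = z x"
    and bc: "z 1 = 0" "(z \<longlongrightarrow> 0) (at_right 0)"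
    and x: "x \<in> {0<..1}"
  shows "z x = 0"
proof -
  have cz': "continuous_on {0<..<1} z" by (rule continuous_on_subset[OF cz]) auto
  obtain A B k where zz: "\<And>x. x \<in> {0<..<1} \<Longrightarrow> z x = A * \<phi> x + B * (\<zeta> x - k * \<phi> x)"
    using very_weak_solution_span[OF cz' orthogonal_to_bumps[OF cz' z w ae]] by blast
  define y where "y = (\<lambda>x. A * \<phi> x + B * (\<zeta> x - k * \<phi> x))"
  have cy: "continuous_on {0..1} y" unfolding y_def by (intro continuous_intros continuous_solutions) auto
  have "(y \<longlongrightarrow> y 0) (at_right 0)"
  proof -
    have "(y \<longlongrightarrow> y 0) (at 0 within {0..1})" using cy by (simp add: continuous_on_def)
    then show ?thesis by (simp add: at_within_Icc_at_right)
  qed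
  moreover have "(y \<longlongrightarrow> 0) (at_right 0)"
  proof (rule Lim_transform_eventually[OF bc(2)])
    show "\<forall>\<^sub>F x in at_right 0. z x = y x"
      using eventually_at_right_less eventually_at_right_real[of 0 "1::real"] zz by (auto simp: y_def elim!: eventually_mono)
  qed
  ultimately have "y 0 = 0" using tendsto_unique trivial_limit_at_right_real by blast
  then have B: "B = 0" by (simp add: y_def phi_0 zeta_0)
  have "z 1 - y 1 = 0"
  proof -
    have "continuous_on {1/2..1} (\<lambda>x. z x - y x)"
      by (intro continuous_intros continuous_on_subset[OF cz] continuous_on_subset[OF cy]) auto
    moreover have "closure {1/2<..<1::real} = {1/2..1}" by simp
    ultimately show ?thesis
      using continuous_constant_on_closure[of "{1/2<..<1}" "\<lambda>x. z x - y x" 0 1] zz by (simp add: y_def)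
  qed
  then have "A * \<phi> 1 = 0" using bc(1) by (simp add: y_def B)
  then have "A = 0" using phi_pos[of 1] by simp
  then show ?thesis using zz[of x] x bc(1) B by (cases "x = 1") auto
qed

lemma dirichlet_solution_unique:
  assumes 1: "dirichlet_solution \<alpha> p f u\<^sub>1" and 2: "dirichlet_solution \<alpha> p f u\<^sub>2" and x: "x \<in> {0<..1}"
  shows "u\<^sub>1 x = u\<^sub>2 x"
proof -
  let ?I = "{0<..<1::real}"
  obtain v1 w1 where 11: "has_weak_derivative ?I u\<^sub>1 v1" "has_weak_derivative ?I (\<lambda>x. x powr (2 * \<alpha>) * v1 x) w1"
     "AE x in lebesgue_on {0<..1}. - w1 x + u\<^sub>1 x = f x"
    using 1 by (auto simp: dirichlet_solution_def satisfies_ode_def)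
  obtain v2 w2 where 22: "has_weak_derivative ?I u\<^sub>2 v2" "has_weak_derivative ?I (\<lambda>x. x powr (2 * \<alpha>) * v2 x) w2"
     "AE x in lebesgue_on {0<..1}. - w2 x + u\<^sub>2 x = f x"
    using 2 by (auto simp: dirichlet_solution_def satisfies_ode_def)
  have "u\<^sub>1 x - u\<^sub>2 x = 0"
  proof (rule homogeneous_dirichlet_zero[OF _ _ _ _ _ _ x])
    show "continuous_on {0<..1} (\<lambda>x. u\<^sub>1 x - u\<^sub>2 x)"
      using 1 2 by (intro continuous_intros) (auto simp: dirichlet_solution_def W2_loc_def)
    show "has_weak_derivative ?I (\<lambda>x. u\<^sub>1 x - u\<^sub>2 x) (\<lambda>x. v1 x - v2 x)"
      by (rule has_weak_derivative_diff[OF open_greaterThanLessThan 11(1) 22(1)])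
    show "has_weak_derivative ?I (\<lambda>x. x powr (2 * \<alpha>) * (v1 x - v2 x)) (\<lambda>x. w1 x - w2 x)"
      using has_weak_derivative_diff[OF open_greaterThanLessThan 11(2) 22(2)] by (simp add: right_diff_distrib)
    have "AE x in lebesgue. x \<in> {0<..1} \<longrightarrow> - w1 x + u\<^sub>1 x = f x" "AE x in lebesgue. x \<in> {0<..1} \<longrightarrow> - w2 x + u\<^sub>2 x = f x"
      using 11(3) 22(3) by (simp_all add: AE_restrict_space_iff)
    then have "AE x in lebesgue. x \<in> ?I \<longrightarrow> w1 x - w2 x = u\<^sub>1 x - u\<^sub>2 x"
      by eventually_elim auto
    then show "AE x in lebesgue_on ?I. w1 x - w2 x = u\<^sub>1 x - u\<^sub>2 x"
      by (simp add: AE_restrict_space_iff)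
    show "u\<^sub>1 1 - u\<^sub>2 1 = 0" "((\<lambda>x. u\<^sub>1 x - u\<^sub>2 x) \<longlongrightarrow> 0) (at_right 0)"
      using 1 2 tendsto_diff[of u\<^sub>1 0 "at_right 0" u\<^sub>2 0] by (auto simp: dirichlet_solution_def)
  qed
  then show ?thesis by simp
qed

end

section \<open>Two-sided bounds\<close>

context homogeneous_solutions
begin

lemma u\<^sub>D_eqI:
  assumes p: "1 \<le> p" and f: "f \<in> Lp p {0<..<1}"
    and cont: "continuous_on {0<..1} u" "continuous_on {0<..1} b"
    and wu: "has_weak_derivative {0<..<1} u (\<lambda>x. x powr (-2 * \<alpha>) * b x)"
    and wb: "has_weak_derivative {0<..<1} b (\<lambda>x. u x - f x)"
    and bc: "u 1 = 0" "(u \<longlongrightarrow> 0) (at_right 0)"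
    and x: "x \<in> {0<..1}"
  shows "u\<^sub>D \<alpha> p f x = u x"
proof -
  define U where "U = restrict u {0<..1}"
  have U: "\<And>x. x \<in> {0<..1} \<Longrightarrow> U x = u x" by (simp add: U_def)
  have "dirichlet_solution \<alpha> p f U"
  proof (rule dirichlet_solutionI[OF p f _ cont(2)])
    show "continuous_on {0<..1} U" using cont(1) by (rule continuous_on_eq) (simp add: U)
    show "has_weak_derivative {0<..<1} U (\<lambda>x. x powr (-2 * \<alpha>) * b x)"
      by (rule has_weak_derivative_cong[OF wu]) (auto simp: U)
    show "has_weak_derivative {0<..<1} b (\<lambda>x. U x - f x)"
      by (rule has_weak_derivative_cong[OF wb]) (auto simp: U)
    show "(U \<longlongrightarrow> 0) (at_right 0)"
    proof (rule Lim_transform_eventually[OF bc(2)])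
      have "\<forall>\<^sub>F x in at_right 0. x \<in> {0<..<1::real}" by (rule eventually_at_right_real) simp
      then show "\<forall>\<^sub>F x in at_right 0. u x = U x" by eventually_elim (simp add: U)
    qed
  qed (simp add: U bc)
  moreover have "U \<in> extensional {0<..1}" by (simp add: U_def)
  moreover have "V = U" if "V \<in> extensional {0<..1}" "dirichlet_solution \<alpha> p f V" for V
    by (rule extensionalityI[OF that(1) \<open>U \<in> extensional {0<..1}\<close>])
      (rule dirichlet_solution_unique[OF that(2) \<open>dirichlet_solution \<alpha> p f U\<close>])
  ultimately have "u\<^sub>D \<alpha> p f = U" unfolding u\<^sub>D_def by (intro the_equality conjI) (assumption | elim conjE)+
  then show ?thesis using U x by simp
qed

text \<open>
  The Green function estimate. In the proof, \<open>- Q(x)\<close> is the integral of \<open>\<psi> f\<close> over \<open>[x,1]\<close>, and the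
  terms containing \<open>f\<close> in the derivative of \<open>u\<close> cancel, those in the derivative of the flux \<open>b\<close> add up to
  \<open>- f\<close> because the Wronskian of \<open>\<phi>\<close> and \<open>\<psi>\<close> is \<open>1\<close>.
\<close>

lemma u\<^sub>D_bound:
  assumes p: "1 \<le> p" and f: "f \<in> Lp p {0<..<1}" "set_integrable lebesgue {0<..<1} f" 
    and A: "\<And>x. x \<in> {0..1} \<Longrightarrow> \<bar>\<zeta> x - \<zeta> 1 / \<phi> 1 * \<phi> x\<bar> \<le> A" and x: "x \<in> {0<..1}"
  shows "\<bar>u\<^sub>D \<alpha> p f x\<bar> \<le> 2 * A * \<phi> x * (LINT x:{0<..<1}|lebesgue. \<bar>f x\<bar>)"
proof -
  let ?I = "{0<..<1::real}"
  define k where "k = \<zeta> 1 / \<phi> 1"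
  define \<psi> where "\<psi> = (\<lambda>x. \<zeta> x - k * \<phi> x)"
  define \<Psi> where "\<Psi> = (\<lambda>x. Z x - k * \<Phi> x)"
  \<comment> \<open>The values of \<open>f\<close> off \<open>(0,1)\<close> are arbitrary, so they are cut off before integrating over \<open>[0,1]\<close>.\<close>
  define F where "F = (\<lambda>x. indicator ?I x * f x)"
  define N where "N = (LINT x:{0<..<1}|lebesgue. \<bar>f x\<bar>)"
  have psi1: "\<psi> 1 = 0" using phi_pos[of 1] by (simp add: \<psi>_def k_def)
  have A': "\<bar>\<psi> x\<bar> \<le> A" if "x \<in> {0..1}" for x using A[OF that] by (simp add: \<psi>_def k_def)
  have A0: "0 \<le> A" using A'[of 0] by simp
  have cc: "continuous_on {0..1} \<phi>" "continuous_on {0..1} \<psi>" unfolding \<psi>_def 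
    by (intro continuous_intros continuous_solutions; simp)+
  have iF: "integrable lebesgue F" using f(2) by (simp add: F_def set_integrable_def)
  then have iF': "set_integrable lebesgue S F" if "S \<in> sets lebesgue" for S
    unfolding set_integrable_def using that by (intro integrable_mult_indicator)
  have ph: "set_integrable lebesgue {0..1} (\<lambda>x. g x * F x)" if "continuous_on {0..1} g" for g :: "real \<Rightarrow> real"
  proof (rule absolutely_integrable_bounded_measurable_product_real)
    show "g \<in> borel_measurable (lebesgue_on {0..1})"
      using that by (rule continuous_imp_measurable_on_sets_lebesgue) auto
    show "bounded (g ` {0..1})" using that by (intro compact_imp_bounded compact_continuous_image) auto
  qed (auto intro: iF')
  have NF: "integral {0..1} (\<lambda>x. \<bar>F x\<bar>) = N"
  proof -
    have "set_integrable lebesgue {0..1} (\<lambda>x. \<bar>F x\<bar>)" using iF'[of "{0..1}"] by (intro set_integrable_abs) auto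
    then have "integral {0..1} (\<lambda>x. \<bar>F x\<bar>) = (LINT x:{0..1}|lebesgue. \<bar>F x\<bar>)"
      by (simp add: set_lebesgue_integral_eq_integral)
    also have "\<dots> = N" unfolding N_def set_lebesgue_integral_def
      by (intro Bochner_Integration.integral_cong) (auto simp: F_def indicator_def)
    finally show ?thesis .
  qed
  have Fi: "(\<lambda>x. \<bar>F x\<bar>) integrable_on {0..1}"
    using set_lebesgue_integral_eq_integral(1)[OF set_integrable_abs[OF iF'[of "{0..1}"]]] by simp
  define P where "P = (\<lambda>x. integral {0..x} (\<lambda>t. \<phi> t * F t))"
  define T where "T = integral {0..1} (\<lambda>t. \<psi> t * F t)"
  define Q where "Q = (\<lambda>x. - T + integral {0..x} (\<lambda>t. \<psi> t * F t))"
  have hk: "(\<lambda>t. \<phi> t * F t) integrable_on {0..1}" "(\<lambda>t. \<psi> t * F t) integrable_on {0..1}"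
    using ph[OF cc(1)] ph[OF cc(2)] by (simp_all add: set_lebesgue_integral_eq_integral)
  have cP: "continuous_on {0..1} P" "continuous_on {0..1} Q" unfolding P_def Q_def
    by (intro continuous_intros indefinite_integral_continuous_1 hk)+
  have wP: "has_weak_derivative ?I P (\<lambda>t. \<phi> t * F t)"
    using has_weak_derivative_primitive[OF ph[OF cc(1)], of 0] by (simp add: P_def)
  have wQ: "has_weak_derivative ?I Q (\<lambda>t. \<psi> t * F t)"
    using has_weak_derivative_primitive[OF ph[OF cc(2)], of "- T"] by (simp add: Q_def)
  define u where "u = (\<lambda>x. \<psi> x * P x - \<phi> x * Q x)"
  define b where "b = (\<lambda>x. \<Psi> x * P x - \<Phi> x * Q x)"
  have psi_d: "(\<psi> has_real_derivative x powr (-2 * \<alpha>) * \<Psi> x) (at x)" if "0 < x" for x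
    unfolding \<psi>_def \<Psi>_def using DERIV_diff[OF zeta_deriv[OF that] DERIV_cmult[OF phi_deriv[OF that], of k]]
    by (simp add: algebra_simps)
  have Psi_d: "(\<Psi> has_real_derivative \<psi> x) (at x)" if "0 < x" for x
    unfolding \<psi>_def \<Psi>_def using DERIV_diff[OF Zeta_deriv[OF that] DERIV_cmult[OF Phi_deriv[OF that], of k]]
    by simp
  have wr: "\<Phi> x * \<psi> x - \<Psi> x * \<phi> x = 1" if "0 < x" for x
    using wronskian[OF that] by (simp add: \<psi>_def \<Psi>_def algebra_simps)
  have cI: "continuous_on S \<Phi>" "continuous_on S \<Psi>" if "S \<subseteq> {0<..}" for S 
    unfolding \<Psi>_def using continuous_fluxes[OF that] by (auto intro!: continuous_intros)
  have sub: "{0<..<1} \<subseteq> {0<..1::real}" "{0<..1} \<subseteq> {0<..1::real}" by auto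
  have cs: "continuous_on S \<phi>" "continuous_on S \<psi>" "continuous_on S P" "continuous_on S Q" 
      "continuous_on S \<Phi>" "continuous_on S \<Psi>" "continuous_on S (\<lambda>x. x powr a)" if "S \<subseteq> {0<..1}" for S a
  proof -
    have "S \<subseteq> {0..1}" "S \<subseteq> {0<..}" using that by auto
    then show "continuous_on S \<phi>" "continuous_on S \<psi>" "continuous_on S P" "continuous_on S Q"
        "continuous_on S \<Phi>" "continuous_on S \<Psi>" "continuous_on S (\<lambda>x. x powr a)" 
      using cc cP cI by (auto intro: continuous_on_subset intro!: continuous_intros)
  qed
  have cu: "continuous_on {0<..1} u" "continuous_on {0<..1} b"
    unfolding u_def b_def by (intro continuous_intros cs sub)+
  have wu: "has_weak_derivative ?I u (\<lambda>x. x powr (-2 * \<alpha>) * b x)"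
  proof -
    have 1: "has_weak_derivative ?I (\<lambda>x. \<psi> x * P x) (\<lambda>x. x powr (-2 * \<alpha>) * \<Psi> x * P x + \<psi> x * (\<phi> x * F x))"
      by (rule has_weak_derivative_mult[OF open_greaterThanLessThan wP])
        (intro psi_d continuous_intros cs sub; simp)+
    have 2: "has_weak_derivative ?I (\<lambda>x. \<phi> x * Q x) (\<lambda>x. x powr (-2 * \<alpha>) * \<Phi> x * Q x + \<phi> x * (\<psi> x * F x))"
      by (rule has_weak_derivative_mult[OF open_greaterThanLessThan wQ])
        (intro phi_deriv continuous_intros cs sub; simp)+
    show ?thesis
      by (rule has_weak_derivative_cong[OF has_weak_derivative_diff[OF open_greaterThanLessThan 1 2]])
        (simp_all add: u_def b_def algebra_simps)
  qed
  have wb: "has_weak_derivative ?I b (\<lambda>x. u x - f x)"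
  proof -
    have 1: "has_weak_derivative ?I (\<lambda>x. \<Psi> x * P x) (\<lambda>x. \<psi> x * P x + \<Psi> x * (\<phi> x * F x))"
      by (rule has_weak_derivative_mult[OF open_greaterThanLessThan wP])
        (intro Psi_d continuous_intros cs sub; simp)+
    have 2: "has_weak_derivative ?I (\<lambda>x. \<Phi> x * Q x) (\<lambda>x. \<phi> x * Q x + \<Phi> x * (\<psi> x * F x))"
      by (rule has_weak_derivative_mult[OF open_greaterThanLessThan wQ])
        (intro Phi_deriv continuous_intros cs sub; simp)+
    show ?thesis
    proof (rule has_weak_derivative_cong[OF has_weak_derivative_diff[OF open_greaterThanLessThan 1 2]])
      fix x :: real assume x: "x \<in> ?I"
      then have w: "\<Phi> x * \<psi> x - \<Psi> x * \<phi> x = 1" "F x = f x" using wr by (auto simp: F_def)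
      show "\<psi> x * P x + \<Psi> x * (\<phi> x * F x) - (\<phi> x * Q x + \<Phi> x * (\<psi> x * F x)) = u x - f x"
        unfolding u_def using w by algebra
    qed (simp add: b_def)
  qed
  have bound: "\<bar>u x\<bar> \<le> 2 * A * \<phi> x * N" if x: "x \<in> {0<..1}" for x
  proof -
    have px: "0 \<le> \<phi> x" using phi_pos[of x] x by simp
    have sI: "{0..x} \<subseteq> {0..1}" "{x..1} \<subseteq> {0..1}" using x by auto
    have "norm (integral {0..x} (\<lambda>t. \<phi> t * F t)) \<le> integral {0..x} (\<lambda>t. \<phi> x * \<bar>F t\<bar>)"
    proof (rule integral_norm_bound_integral)
      show "(\<lambda>t. \<phi> t * F t) integrable_on {0..x}" "(\<lambda>t. \<phi> x * \<bar>F t\<bar>) integrable_on {0..x}"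
        using integrable_subinterval_real[OF hk(1) sI(1)] integrable_subinterval_real[OF Fi sI(1)]
        by (auto intro: integrable_on_mult_right)
      show "norm (\<phi> t * F t) \<le> \<phi> x * \<bar>F t\<bar>" if "t \<in> {0..x}" for t
        using that phi_mono[of t x] phi_mono[of 0 t] by (auto simp: abs_mult phi_0 intro!: mult_right_mono)
    qed
    also have "\<dots> = \<phi> x * integral {0..x} (\<lambda>t. \<bar>F t\<bar>)" by simp
    also have "\<dots> \<le> \<phi> x * N" unfolding NF[symmetric] using px sI Fi integrable_subinterval_real[OF Fi sI(1)]
      by (intro mult_left_mono integral_subset_le) auto
    finally have 1: "\<bar>P x\<bar> \<le> \<phi> x * N" by (simp add: P_def)
    have "integral {0..x} (\<lambda>t. \<psi> t * F t) + integral {x..1} (\<lambda>t. \<psi> t * F t) = T"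
      unfolding T_def using x hk(2) by (intro Henstock_Kurzweil_Integration.integral_combine) auto
    then have "\<bar>Q x\<bar> = norm (integral {x..1} (\<lambda>t. \<psi> t * F t))" by (simp add: Q_def)
    also have "\<dots> \<le> integral {x..1} (\<lambda>t. A * \<bar>F t\<bar>)"
    proof (rule integral_norm_bound_integral)
      show "(\<lambda>t. \<psi> t * F t) integrable_on {x..1}" "(\<lambda>t. A * \<bar>F t\<bar>) integrable_on {x..1}"
        using integrable_subinterval_real[OF hk(2) sI(2)] integrable_subinterval_real[OF Fi sI(2)]
        by (auto intro: integrable_on_mult_right)
      show "norm (\<psi> t * F t) \<le> A * \<bar>F t\<bar>" if "t \<in> {x..1}" for t
        using that x A'[of t] by (auto simp: abs_mult intro!: mult_right_mono)
    qed
    also have "\<dots> = A * integral {x..1} (\<lambda>t. \<bar>F t\<bar>)" by simp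
    also have "\<dots> \<le> A * N" unfolding NF[symmetric] using A0 sI Fi integrable_subinterval_real[OF Fi sI(2)]
      by (intro mult_left_mono integral_subset_le) auto
    finally have 2: "\<bar>Q x\<bar> \<le> A * N" .
    have "\<bar>u x\<bar> \<le> \<bar>\<psi> x\<bar> * \<bar>P x\<bar> + \<bar>\<phi> x\<bar> * \<bar>Q x\<bar>" 
      unfolding u_def by (metis abs_mult abs_triangle_ineq4)
    also have "\<dots> \<le> A * (\<phi> x * N) + \<phi> x * (A * N)"
      using 1 2 A'[of x] A0 px x by (intro add_mono mult_mono) auto
    finally show ?thesis by (simp add: algebra_simps)
  qed
  have u0: "(u \<longlongrightarrow> 0) (at_right 0)"
  proof (rule Lim_null_comparison)
    have "\<forall>\<^sub>F x in at_right 0. x \<in> {0<..<1::real}" by (rule eventually_at_right_real) simp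
    then show "\<forall>\<^sub>F x in at_right 0. norm (u x) \<le> 2 * A * \<phi> x * N"
      by eventually_elim (use bound in auto)
    have "(\<phi> \<longlongrightarrow> \<phi> 0) (at 0 within {0..1})" using cc(1) by (simp add: continuous_on_def)
    then have "(\<phi> \<longlongrightarrow> 0) (at_right 0)" by (simp add: at_within_Icc_at_right phi_0)
    then show "((\<lambda>x. 2 * A * \<phi> x * N) \<longlongrightarrow> 0) (at_right 0)"
      by (auto intro!: tendsto_eq_intros)
  qed
  have "Q 1 = 0" by (simp add: Q_def T_def)
  then have u1: "u 1 = 0" by (simp add: u_def psi1)
  show ?thesis using u\<^sub>D_eqI[OF p f(1) cu wu wb u1 u0 x] bound[OF x] unfolding N_def by simp
qed

lemma K\<^sub>D_upper_bound:
  assumes p: "1 \<le> p"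
  obtains C where "\<And>x. 0 < x \<Longrightarrow> x \<le> 1 \<Longrightarrow> K\<^sub>D \<alpha> p x \<le> ennreal C"
proof -
  have "continuous_on {0..1} (\<lambda>x. \<zeta> x - \<zeta> 1 / \<phi> 1 * \<phi> x)" 
    by (intro continuous_intros continuous_solutions) auto
  then have "bounded ((\<lambda>x. \<zeta> x - \<zeta> 1 / \<phi> 1 * \<phi> x) ` {0..1})"
    by (intro compact_imp_bounded compact_continuous_image) auto
  then obtain A where A: "\<And>x. x \<in> {0..1} \<Longrightarrow> \<bar>\<zeta> x - \<zeta> 1 / \<phi> 1 * \<phi> x\<bar> \<le> A"
    unfolding bounded_real by blast
  have A0: "0 \<le> A" using A[of 0] by simp
  have "K\<^sub>D \<alpha> p x \<le> ennreal (4 * A * M)" if x: "0 < x" "x \<le> 1" for x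
    unfolding K\<^sub>D_def
  proof (rule SUP_least)
    fix f assume f: "f \<in> {f \<in> Lp p {0<..<1}. Lp_norm p {0<..<1} f \<le> 1}"
    note L1 = unit_ball_L1[OF p, of f]
    have "\<bar>u\<^sub>D \<alpha> p f x\<bar> \<le> 2 * A * \<phi> x * (LINT x:{0<..<1}|lebesgue. \<bar>f x\<bar>)"
      using f L1 x by (intro u\<^sub>D_bound p A) auto
    also have "\<dots> \<le> 2 * A * \<phi> x * 2" 
      using f L1 A0 phi_pos[of x] x by (intro mult_left_mono) auto
    also have "\<dots> \<le> 2 * A * (M * x powr (1 - 2 * \<alpha>)) * 2"
      using A0 phi_le[of x] x by (intro mult_right_mono mult_left_mono) auto
    finally have "x powr (2 * \<alpha> - 1) * \<bar>u\<^sub>D \<alpha> p f x\<bar> \<le> x powr (2 * \<alpha> - 1) * (4 * A * M * x powr (1 - 2 * \<alpha>))"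
      by (intro mult_left_mono) (auto simp: algebra_simps)
    also have "\<dots> = 4 * A * M * x powr ((2 * \<alpha> - 1) + (1 - 2 * \<alpha>))"
      unfolding powr_add by simp
    also have "\<dots> = 4 * A * M" using x by simp
    finally show "ennreal \<bar>x powr (2 * \<alpha> - 1) * u\<^sub>D \<alpha> p f x\<bar> \<le> ennreal (4 * A * M)"
      by (intro ennreal_leI) (simp add: abs_mult)
  qed
  then show thesis using that by blast
qed

text \<open>
  A single explicit datum suffices: \<open>u = x\<^sup>r (1 - x) / (r B)\<close> with flux \<open>(1 - (r + 1) x / r) / B\<close>, where \<open>B\<close>
  normalises \<open>f = u - (a u')'\<close> to \<open>|f| \<le> 1\<close>.
\<close>

lemma K\<^sub>D_lower_bound:
  assumes p: "1 \<le> p"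
  obtains c where "0 < c" "\<And>x. 0 < x \<Longrightarrow> x \<le> 1 / 2 \<Longrightarrow> ennreal c \<le> K\<^sub>D \<alpha> p x"
proof -
  let ?I = "{0<..<1::real}"
  define r where "r = 1 - 2 * \<alpha>"
  have r: "0 < r" using alpha by (simp add: r_def)
  define B where "B = (r + 1) / r + 1 / r"
  have B: "0 < B" using r by (simp add: B_def add_pos_pos)
  define u where "u = (\<lambda>x. x powr r * (1 - x) / (r * B))"
  define b where "b = (\<lambda>x. (1 - (r + 1) / r * x) / B)"
  define f where "f = (\<lambda>x. (r + 1) / r / B + u x)"
  have cu: "continuous_on S u" if "S \<subseteq> {0..}" for S unfolding u_def using r B that
    by (intro continuous_intros continuous_on_powr') auto
  have cb: "continuous_on S b" for S unfolding b_def using B by (intro continuous_intros) auto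
  have cf: "continuous_on ?I f" unfolding f_def by (intro continuous_intros cu) auto
  have fb: "\<bar>f x\<bar> \<le> 1" if x: "x \<in> ?I" for x
  proof -
    have "0 \<le> x powr r" "x powr r \<le> 1" using x r by (auto intro: powr_le1)
    then have "0 \<le> x powr r * (1 - x)" "x powr r * (1 - x) \<le> 1" using x by (auto intro: mult_le_one)
    then have "0 \<le> u x" "u x \<le> 1 / (r * B)" using r B by (auto simp: u_def intro!: divide_right_mono)
    then have "\<bar>f x\<bar> \<le> (r + 1) / r / B + 1 / (r * B)" using r B by (simp add: f_def)
    also have "\<dots> = ((r + 1) / r + 1 / r) / B" by (simp add: add_divide_distrib)
    also have "\<dots> = 1" using B by (simp add: B_def)
    finally show ?thesis .
  qed
  have mf: "f \<in> borel_measurable (lebesgue_on ?I)"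
    by (rule continuous_imp_measurable_on_sets_lebesgue[OF cf]) auto
  have fL: "f \<in> Lp p ?I"
    by (rule bounded_mem_Lp[OF p _ mf fb]) (auto simp: bounded_set_imp_lmeasurable)
  have fn: "Lp_norm p ?I f \<le> 1" by (rule Lp_norm_le_1[OF p mf fb])
  have lip: "has_weak_derivative ?I g g'" 
    if "\<And>x. x \<in> ?I \<Longrightarrow> (g has_real_derivative g' x) (at x)" "continuous_on ?I g'" for g g'
  proof -
    have "(\<lambda>_. 0::real) absolutely_integrable_on {0..1::real}" by (simp add: set_integrable_def)
    from has_weak_derivative_primitive[OF this, of 1]
    have "has_weak_derivative ?I (\<lambda>_. 1) (\<lambda>_. 0)" by simp
    from has_weak_derivative_mult[OF open_greaterThanLessThan this that] show ?thesis by simp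
  qed
  have wu: "has_weak_derivative ?I u (\<lambda>x. x powr (-2 * \<alpha>) * b x)"
  proof (rule lip)
    fix x assume x: "x \<in> ?I"
    have "(u has_real_derivative (r * x powr (r - 1) * (1 - x) + (0 - 1) * x powr r) / (r * B)) (at x)"
      unfolding u_def using x by (intro DERIV_cdivide DERIV_mult DERIV_diff DERIV_const DERIV_ident has_real_derivative_powr) auto
    moreover have "x powr r = x powr (r - 1) * x" using x by (simp add: powr_diff)
    then have "(r * x powr (r - 1) * (1 - x) + (0 - 1) * x powr r) / (r * B) = x powr (r - 1) * b x"
      using r B by (simp add: b_def field_simps)
    ultimately show "(u has_real_derivative x powr (-2 * \<alpha>) * b x) (at x)" by (simp add: r_def)
  qed (intro continuous_intros cb; simp)
  have wb: "has_weak_derivative ?I b (\<lambda>x. u x - f x)"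
  proof (rule lip)
    show "(b has_real_derivative u x - f x) (at x)" for x
      unfolding b_def f_def using B r by (auto intro!: derivative_eq_intros)
  qed (intro continuous_intros cu cf; auto)
  have u0: "(u \<longlongrightarrow> 0) (at_right 0)"
  proof -
    have "continuous_on {0..1} u" by (rule cu) auto
    then have "(u \<longlongrightarrow> u 0) (at 0 within {0..1})" by (simp add: continuous_on_def)
    then show ?thesis by (simp add: at_within_Icc_at_right u_def)
  qed
  have u1: "u 1 = 0" by (simp add: u_def)
  have c1: "continuous_on {0<..1} u" by (rule cu) auto
  have uD: "u\<^sub>D \<alpha> p f x = u x" if "x \<in> {0<..1}" for x
    by (rule u\<^sub>D_eqI[OF p fL c1 cb wu wb u1 u0 that])
  show thesis
  proof (rule that)
    show "0 < 1 / (2 * r * B)" using r B by simp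
    fix x :: real assume x: "0 < x" "x \<le> 1 / 2"
    have "x powr (2 * \<alpha> - 1) * x powr r = x powr ((2 * \<alpha> - 1) + r)" by (simp only: powr_add)
    also have "\<dots> = 1" using x by (simp add: r_def)
    finally have "x powr (2 * \<alpha> - 1) * u x = (1 - x) / (r * B)" by (simp add: u_def)
    moreover have "1 / (2 * r * B) \<le> (1 - x) / (r * B)" using x r B by (simp add: field_simps)
    ultimately have "ennreal (1 / (2 * r * B)) \<le> ennreal \<bar>x powr (2 * \<alpha> - 1) * u\<^sub>D \<alpha> p f x\<bar>"
      using x uD[of x] r B by (intro ennreal_leI) (simp add: abs_of_pos)
    also have "\<dots> \<le> K\<^sub>D \<alpha> p x" unfolding K\<^sub>D_def using fL fn by (intro SUP_upper) simp
    finally show "ennreal (1 / (2 * r * B)) \<le> K\<^sub>D \<alpha> p x" .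
  qed
qed

end

theorem mainTheorem3:
  fixes \<alpha> :: real and p :: ennreal
  assumes "\<alpha> < 1 / 2" and "1 \<le> p"
  shows "\<exists>\<epsilon>\<^sub>0 C\<^sub>1 C\<^sub>2 :: real. 0 < \<epsilon>\<^sub>0 \<and> \<epsilon>\<^sub>0 \<le> 1 \<and> 0 < C\<^sub>1 \<and> C\<^sub>1 < C\<^sub>2 \<and>
           (\<forall>x. 0 < x \<and> x \<le> \<epsilon>\<^sub>0 \<longrightarrow> ennreal C\<^sub>1 \<le> K\<^sub>D \<alpha> p x \<and> K\<^sub>D \<alpha> p x \<le> ennreal C\<^sub>2)"
proof -
  obtain \<phi> \<Phi> \<zeta> Z M where "homogeneous_solutions \<alpha> \<phi> \<Phi> \<zeta> Z M"
    using homogeneous_solutions_exist[OF assms(1)] by blast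
  then interpret homogeneous_solutions \<alpha> \<phi> \<Phi> \<zeta> Z M .
  obtain C where C: "\<And>x. 0 < x \<Longrightarrow> x \<le> 1 \<Longrightarrow> K\<^sub>D \<alpha> p x \<le> ennreal C"
    using K\<^sub>D_upper_bound[OF assms(2)] by blast
  obtain c where c: "0 < c" "\<And>x. 0 < x \<Longrightarrow> x \<le> 1 / 2 \<Longrightarrow> ennreal c \<le> K\<^sub>D \<alpha> p x"
    using K\<^sub>D_lower_bound[OF assms(2)] by blast
  have "K\<^sub>D \<alpha> p x \<le> ennreal (max C (c + 1))" if "0 < x" "x \<le> 1 / 2" for x
  proof -
    have "K\<^sub>D \<alpha> p x \<le> ennreal C" using that by (intro C) auto
    also have "\<dots> \<le> ennreal (max C (c + 1))" by (intro ennreal_leI) simp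
    finally show ?thesis .
  qed
  then show ?thesis
    using c by (intro exI[of _ "1/2"] exI[of _ c] exI[of _ "max C (c + 1)"]) auto
qed

end
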